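(* Let $(A,[-,-]_A)$ be a Leibniz algebra and let $r\in A\otimes A$ satisfy $F(x)(r-\sigma(r))=0$ for all $x\in A$. Then the following conditions are equivalent: (a) $r$ is a solution of the classical Leibniz Yang-Baxter equation in $(A,[-,-]_A)$, such that $(A,[-,-]_A,\Delta_r)$ with $\Delta_r(x)=F(x)r$ is a quasi-triangular Leibniz bialgebra. (b) $T_r$ is a relative Rota-Baxter operator of weight $-1$ on $(A,[-,-]_A)$ with respect to the $A$-Leibniz algebra $(\mathcal{L}_A^*,-\mathcal{L}_A^*-\mathcal{R}_A^*,A^*,\circ_{r-\sigma(r)})$, where the multiplication $\circ_{r-\sigma(r)}$ on $A^*$ is given by \[ a^*\circ_{r-\sigma(r)}b^*=\mathcal{L}_A^*(T_{r-\sigma(r)}(a^* ))b^*,\qquad\forall a^*,b^*\in A^*. \] That is, for all $a^*,b^*\in A^*$, \[ [T_r(a^* ),T_r(b^* )]_A=T_r\big(\mathcal{L}_A^*(T_r(a^* ))b^*-(\mathcal{L}_A^*+\mathcal{R}_A^* )(T_r(b^* ))a^*-a^*\circ_{r-\sigma(r)}b^*\big). \]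
   Context: All vector spaces and algebras are finite-dimensional over an algebraically closed field $\mathbb{K}$ of characteristic zero. A (left) Leibniz algebra is a vector space $A$ with a bilinear multiplication $[-,-]_A$ satisfying $[x,[y,z]_A]_A=[[x,y]_A,z]_A+[y,[x,z]_A]_A$. Define $\mathcal{L}_A(x)y=[x,y]_A=\mathcal{R}_A(y)x$, $\sigma(x\otimes y)=y\otimes x$, and $F(x)=(\mathcal{L}_A+\mathcal{R}_A)(x)\otimes\mathrm{id}-\mathrm{id}\otimes\mathcal{R}_A(x)\in\mathrm{End}(A\otimes A)$. For a linear map $f:A\to\mathrm{End}(V)$, $f^*:A\to\mathrm{End}(V^* )$ is defined by $\langle f^*(x)u^*,v\rangle=-\langle u^*,f(x)v\rangle$. For $r=\sum_i a_i\otimes b_i\in A\otimes A$ put $[[r,r]]=\sum_{i,j}\big([a_i,a_j]_A\otimes b_i\otimes b_j-a_i\otimes([b_i,a_j]_A+[a_j,b_i]_A)\otimes b_j+a_i\otimes a_j\otimes[b_j,b_i]_A\big)$; $r$ is a solution of the classical Leibniz Yang-Baxter equation if $[[r,r]]=0$. If $r$ is such a solution and $F(x)(r-\sigma(r))=0$ for all $x\in A$, then $(A,[-,-]_A,\Delta_r)$ with $\Delta_r(x)=F(x)r$ (which is then a Leibniz bialgebra) is called a quasi-triangular Leibniz bialgebra. For $s\in A\otimes A$, $T_s:A^*\to A$ is given by $\langle T_s(a^* ),b^*\rangle=\langle s,a^*\otimes b^*\rangle$. A representation of $(A,[-,-]_A)$ is a triple $(l,\rho,V)$ with $V$ a vector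 space and $l,\rho:A\to\mathrm{End}(V)$ linear such that $l([x,y]_A)=l(x)l(y)-l(y)l(x)$, $\rho([x,y]_A)=l(x)\rho(y)-\rho(y)l(x)$, $\rho(y)l(x)=-\rho(y)\rho(x)$ for all $x,y\in A$. If in addition $(V,[-,-]_V)$ is a Leibniz algebra and for all $x\in A$, $u,v\in V$ \[ l(x)[u,v]_V=[l(x)u,v]_V+[u,l(x)v]_V,\quad [u,l(x)v]_V=[\rho(x)u,v]_V+l(x)[u,v]_V,\quad [u,\rho(x)v]_V=\rho(x)[u,v]_V+[v,\rho(x)u]_V, \] then $(l,\rho,V,[-,-]_V)$ is called an $A$-Leibniz algebra. A relative Rota-Baxter operator of weight $\lambda\in\mathbb{K}$ on $(A,[-,-]_A)$ with respect to $(l,\rho,V,[-,-]_V)$ is a linear map $T:V\to A$ with $[Tu,Tv]_A=T(l(Tu)v+\rho(Tv)u+\lambda[u,v]_V)$ for all $u,v\in V$. *)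

theory Defs
  imports
    "HOL-Computational_Algebra.Polynomial"
    "HOL-Library.Function_Algebras"
begin

section \<open>Carrier-based linear algebra\<close>

text \<open>
  The Leibniz algebra \<open>A\<close> is carried by a whole type \<open>'a\<close> with scalar multiplication \<open>s\<close>.  Its dual
  is only a subspace of the function type \<open>'a \<Rightarrow> 'k\<close>, so the notions that have to be applied
  to the dual take a subspace of the ambient type as carrier.
\<close>

definition fin_dim_space :: "('k::field \<Rightarrow> 'v::ab_group_add \<Rightarrow> 'v) \<Rightarrow> 'v set \<Rightarrow> bool" where
  "fin_dim_space s V \<longleftrightarrow>
     vector_space s \<and> module.subspace s V \<and> (\<exists>B. finite B \<and> module.span s B = V)"

definition linear_map_on ::
  "('k::field \<Rightarrow> 'v::ab_group_add \<Rightarrow> 'v) \<Rightarrow> 'v set \<Rightarrow> ('k \<Rightarrow> 'w::ab_group_add \<Rightarrow> 'w) \<Rightarrow> 'w set \<Rightarrow> ('v \<Rightarrow> 'w) \<Rightarrow> bool"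
where
  "linear_map_on s V t W f \<longleftrightarrow>
     (\<forall>x\<in>V. f x \<in> W) \<and> (\<forall>x\<in>V. \<forall>y\<in>V. f (x + y) = f x + f y) \<and> (\<forall>c. \<forall>x\<in>V. f (s c x) = t c (f x))"

definition bilinear_map_on ::
  "('k::field \<Rightarrow> 'u::ab_group_add \<Rightarrow> 'u) \<Rightarrow> 'u set \<Rightarrow> ('k \<Rightarrow> 'v::ab_group_add \<Rightarrow> 'v) \<Rightarrow> 'v set \<Rightarrow>
   ('k \<Rightarrow> 'w::ab_group_add \<Rightarrow> 'w) \<Rightarrow> 'w set \<Rightarrow> ('u \<Rightarrow> 'v \<Rightarrow> 'w) \<Rightarrow> bool"
where
  "bilinear_map_on s U t V q W f \<longleftrightarrow>
     (\<forall>x\<in>U. linear_map_on t V q W (f x)) \<and> (\<forall>y\<in>V. linear_map_on s U q W (\<lambda>x. f x y))"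

section \<open>Leibniz algebras, representations, relative Rota-Baxter operators\<close>

definition leibniz_algebra ::
  "('k::field \<Rightarrow> 'v::ab_group_add \<Rightarrow> 'v) \<Rightarrow> 'v set \<Rightarrow> ('v \<Rightarrow> 'v \<Rightarrow> 'v) \<Rightarrow> bool"
where
  "leibniz_algebra s V br \<longleftrightarrow>
     fin_dim_space s V \<and> bilinear_map_on s V s V s V br \<and>
     (\<forall>x\<in>V. \<forall>y\<in>V. \<forall>z\<in>V. br x (br y z) = br (br x y) z + br y (br x z))"

definition leibniz_representation ::
  "('k::field \<Rightarrow> 'a::ab_group_add \<Rightarrow> 'a) \<Rightarrow> ('a \<Rightarrow> 'a \<Rightarrow> 'a) \<Rightarrow>
   ('a \<Rightarrow> 'v \<Rightarrow> 'v) \<Rightarrow> ('a \<Rightarrow> 'v \<Rightarrow> 'v) \<Rightarrow> ('k \<Rightarrow> 'v::ab_group_add \<Rightarrow> 'v) \<Rightarrow> 'v set \<Rightarrow> bool"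
where
  "leibniz_representation s br l \<rho> t V \<longleftrightarrow>
     fin_dim_space t V \<and> bilinear_map_on s UNIV t V t V l \<and> bilinear_map_on s UNIV t V t V \<rho> \<and>
     (\<forall>x y. \<forall>v\<in>V.
        l (br x y) v = l x (l y v) - l y (l x v) \<and>
        \<rho> (br x y) v = l x (\<rho> y v) - \<rho> y (l x v) \<and>
        \<rho> y (l x v) = - \<rho> y (\<rho> x v))"

definition A_leibniz_algebra ::
  "('k::field \<Rightarrow> 'a::ab_group_add \<Rightarrow> 'a) \<Rightarrow> ('a \<Rightarrow> 'a \<Rightarrow> 'a) \<Rightarrow>
   ('a \<Rightarrow> 'v \<Rightarrow> 'v) \<Rightarrow> ('a \<Rightarrow> 'v \<Rightarrow> 'v) \<Rightarrow> ('k \<Rightarrow> 'v::ab_group_add \<Rightarrow> 'v) \<Rightarrow> 'v set \<Rightarrow> ('v \<Rightarrow> 'v \<Rightarrow> 'v) \<Rightarrow> bool"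
where
  "A_leibniz_algebra s br l \<rho> t V brV \<longleftrightarrow>
     leibniz_representation s br l \<rho> t V \<and> leibniz_algebra t V brV \<and>
     (\<forall>x. \<forall>u\<in>V. \<forall>v\<in>V.
        l x (brV u v) = brV (l x u) v + brV u (l x v) \<and>
        brV u (l x v) = brV (\<rho> x u) v + l x (brV u v) \<and>
        brV u (\<rho> x v) = \<rho> x (brV u v) + brV v (\<rho> x u))"

definition relative_rota_baxter_operator ::
  "'k \<Rightarrow> ('k::field \<Rightarrow> 'a::ab_group_add \<Rightarrow> 'a) \<Rightarrow> ('a \<Rightarrow> 'a \<Rightarrow> 'a) \<Rightarrow>
   ('a \<Rightarrow> 'v \<Rightarrow> 'v) \<Rightarrow> ('a \<Rightarrow> 'v \<Rightarrow> 'v) \<Rightarrow> ('k \<Rightarrow> 'v::ab_group_add \<Rightarrow> 'v) \<Rightarrow> 'v set \<Rightarrow> ('v \<Rightarrow> 'v \<Rightarrow> 'v) \<Rightarrow>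
   ('v \<Rightarrow> 'a) \<Rightarrow> bool"
where
  "relative_rota_baxter_operator lam s br l \<rho> t V brV T \<longleftrightarrow>
     leibniz_algebra s UNIV br \<and> A_leibniz_algebra s br l \<rho> t V brV \<and> linear_map_on t V s UNIV T \<and>
     (\<forall>u\<in>V. \<forall>v\<in>V. br (T u) (T v) = T (l (T u) v + \<rho> (T v) u + t lam (brV u v)))"

section \<open>The dual space\<close>

definition dual_space :: "('k::field \<Rightarrow> 'a::ab_group_add \<Rightarrow> 'a) \<Rightarrow> ('a \<Rightarrow> 'k) set" where
  "dual_space s = {u. Vector_Spaces.linear s (*) u}"

definition dual_scale :: "'k::field \<Rightarrow> ('a \<Rightarrow> 'k) \<Rightarrow> 'a \<Rightarrow> 'k" where
  "dual_scale c u = (\<lambda>x. c * u x)"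

definition dual_rep :: "('a \<Rightarrow> 'v \<Rightarrow> 'v) \<Rightarrow> 'a \<Rightarrow> ('v \<Rightarrow> 'k::field) \<Rightarrow> 'v \<Rightarrow> 'k" where
  "dual_rep f x u = (\<lambda>v. - u (f x v))"

section \<open>Tensor powers\<close>

text \<open>
  The tensor product of \<open>A\<close> with itself is realised inside the dual of the space of bilinear forms
  on \<open>A\<close>: the pure tensor of \<open>a\<close> and \<open>b\<close> is evaluation of bilinear forms at \<open>(a, b)\<close>.  Elements of
  the function type are normalised to vanish off the bilinear forms, so equality of tensors is
  equality in HOL.  Over a field bilinear forms separate the elements of the tensor square, hence
  this is the usual tensor product; it is spanned by pure tensors, and scalars are absorbed in
  the first factor.  The threefold tensor power is treated in the same way.
\<close>

definition bilinear_form :: "('k::field \<Rightarrow> 'a::ab_group_add \<Rightarrow> 'a) \<Rightarrow> ('a \<Rightarrow> 'a \<Rightarrow> 'k) \<Rightarrow> bool" where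
  "bilinear_form s \<beta> \<longleftrightarrow>
     (\<forall>a. Vector_Spaces.linear s (*) (\<lambda>b. \<beta> a b)) \<and> (\<forall>b. Vector_Spaces.linear s (*) (\<lambda>a. \<beta> a b))"

definition trilinear_form :: "('k::field \<Rightarrow> 'a::ab_group_add \<Rightarrow> 'a) \<Rightarrow> ('a \<Rightarrow> 'a \<Rightarrow> 'a \<Rightarrow> 'k) \<Rightarrow> bool" where
  "trilinear_form s \<tau> \<longleftrightarrow>
     (\<forall>a b. Vector_Spaces.linear s (*) (\<lambda>c. \<tau> a b c)) \<and>
     (\<forall>a c. Vector_Spaces.linear s (*) (\<lambda>b. \<tau> a b c)) \<and>
     (\<forall>b c. Vector_Spaces.linear s (*) (\<lambda>a. \<tau> a b c))"

type_synonym ('a, 'k) tensor2 = "('a \<Rightarrow> 'a \<Rightarrow> 'k) \<Rightarrow> 'k"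
type_synonym ('a, 'k) tensor3 = "('a \<Rightarrow> 'a \<Rightarrow> 'a \<Rightarrow> 'k) \<Rightarrow> 'k"

definition tensor2 :: "('k::field \<Rightarrow> 'a::ab_group_add \<Rightarrow> 'a) \<Rightarrow> 'a \<Rightarrow> 'a \<Rightarrow> ('a, 'k) tensor2" where
  "tensor2 s a b = (\<lambda>\<beta>. if bilinear_form s \<beta> then \<beta> a b else 0)"

definition tensor3 :: "('k::field \<Rightarrow> 'a::ab_group_add \<Rightarrow> 'a) \<Rightarrow> 'a \<Rightarrow> 'a \<Rightarrow> 'a \<Rightarrow> ('a, 'k) tensor3" where
  "tensor3 s a b c = (\<lambda>\<tau>. if trilinear_form s \<tau> then \<tau> a b c else 0)"

definition tensor2_space :: "('k::field \<Rightarrow> 'a::ab_group_add \<Rightarrow> 'a) \<Rightarrow> ('a, 'k) tensor2 set" where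
  "tensor2_space s = {r. \<exists>n a b. r = (\<Sum>i<(n::nat). tensor2 s (a i) (b i))}"

definition tensor_map ::
  "('k::field \<Rightarrow> 'a::ab_group_add \<Rightarrow> 'a) \<Rightarrow> ('a \<Rightarrow> 'a) \<Rightarrow> ('a \<Rightarrow> 'a) \<Rightarrow> ('a, 'k) tensor2 \<Rightarrow> ('a, 'k) tensor2"
where
  "tensor_map s f g r = (\<lambda>\<beta>. if bilinear_form s \<beta> then r (\<lambda>a b. \<beta> (f a) (g b)) else 0)"

definition tensor_swap :: "('a, 'k) tensor2 \<Rightarrow> ('a, 'k) tensor2" where
  "tensor_swap r = (\<lambda>\<beta>. r (\<lambda>a b. \<beta> b a))"

definition tensor_pairing :: "('a, 'k::field) tensor2 \<Rightarrow> ('a \<Rightarrow> 'k) \<Rightarrow> ('a \<Rightarrow> 'k) \<Rightarrow> 'k" where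
  "tensor_pairing r u v = r (\<lambda>a b. u a * v b)"

section \<open>The classical Leibniz Yang-Baxter equation\<close>

definition T_op ::
  "('k::field \<Rightarrow> 'a::ab_group_add \<Rightarrow> 'a) \<Rightarrow> ('a, 'k) tensor2 \<Rightarrow> ('a \<Rightarrow> 'k) \<Rightarrow> 'a"
where
  "T_op s r u = (THE x. \<forall>v\<in>dual_space s. v x = tensor_pairing r u v)"

definition F_op ::
  "('k::field \<Rightarrow> 'a::ab_group_add \<Rightarrow> 'a) \<Rightarrow> ('a \<Rightarrow> 'a \<Rightarrow> 'a) \<Rightarrow> 'a \<Rightarrow> ('a, 'k) tensor2 \<Rightarrow> ('a, 'k) tensor2"
where
  "F_op s br x r = tensor_map s (\<lambda>y. br x y + br y x) id r - tensor_map s id (\<lambda>y. br y x) r"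

definition coboundary ::
  "('k::field \<Rightarrow> 'a::ab_group_add \<Rightarrow> 'a) \<Rightarrow> ('a \<Rightarrow> 'a \<Rightarrow> 'a) \<Rightarrow> ('a, 'k) tensor2 \<Rightarrow> 'a \<Rightarrow> ('a, 'k) tensor2"
where
  "coboundary s br r = (\<lambda>x. F_op s br x r)"

definition yang_baxter_sum ::
  "('k::field \<Rightarrow> 'a::ab_group_add \<Rightarrow> 'a) \<Rightarrow> ('a \<Rightarrow> 'a \<Rightarrow> 'a) \<Rightarrow> nat \<Rightarrow> (nat \<Rightarrow> 'a) \<Rightarrow> (nat \<Rightarrow> 'a) \<Rightarrow> ('a, 'k) tensor3"
where
  "yang_baxter_sum s br n a b = (\<Sum>i<n. \<Sum>j<n.
       tensor3 s (br (a i) (a j)) (b i) (b j)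
     - tensor3 s (a i) (br (b i) (a j) + br (a j) (b i)) (b j)
     + tensor3 s (a i) (a j) (br (b j) (b i)))"

text \<open>\<open>yang_baxter_unique\<close> below shows that the value does not depend on the chosen decomposition.\<close>

definition yang_baxter ::
  "('k::field \<Rightarrow> 'a::ab_group_add \<Rightarrow> 'a) \<Rightarrow> ('a \<Rightarrow> 'a \<Rightarrow> 'a) \<Rightarrow> ('a, 'k) tensor2 \<Rightarrow> ('a, 'k) tensor3"
where
  "yang_baxter s br r =
     (THE t. \<exists>n a b. r = (\<Sum>i<n. tensor2 s (a i) (b i)) \<and> t = yang_baxter_sum s br n a b)"

definition lybe_solution ::
  "('k::field \<Rightarrow> 'a::ab_group_add \<Rightarrow> 'a) \<Rightarrow> ('a \<Rightarrow> 'a \<Rightarrow> 'a) \<Rightarrow> ('a, 'k) tensor2 \<Rightarrow> bool"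
where
  "lybe_solution s br r \<longleftrightarrow> r \<in> tensor2_space s \<and> yang_baxter s br r = 0"

text \<open>The representations \<open>\<L>\<^sub>A\<^sup>*\<close>, \<open>\<R>\<^sub>A\<^sup>*\<close> on the dual, and the product that \<open>t\<close> induces there.\<close>

definition L_dual :: "('a \<Rightarrow> 'a \<Rightarrow> 'a) \<Rightarrow> 'a \<Rightarrow> ('a \<Rightarrow> 'k::field) \<Rightarrow> 'a \<Rightarrow> 'k" where
  "L_dual br = dual_rep (\<lambda>x y. br x y)"

definition R_dual :: "('a \<Rightarrow> 'a \<Rightarrow> 'a) \<Rightarrow> 'a \<Rightarrow> ('a \<Rightarrow> 'k::field) \<Rightarrow> 'a \<Rightarrow> 'k" where
  "R_dual br = dual_rep (\<lambda>x y. br y x)"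

definition circ ::
  "('k::field \<Rightarrow> 'a::ab_group_add \<Rightarrow> 'a) \<Rightarrow> ('a \<Rightarrow> 'a \<Rightarrow> 'a) \<Rightarrow> ('a, 'k) tensor2 \<Rightarrow>
   ('a \<Rightarrow> 'k) \<Rightarrow> ('a \<Rightarrow> 'k) \<Rightarrow> 'a \<Rightarrow> 'k"
where
  "circ s br t u v = L_dual br (T_op s t u) v"

section \<open>Leibniz bialgebras\<close>

text \<open>
  The cobracket is required to make the dual a Leibniz algebra, and to satisfy the two
  compatibility conditions for left Leibniz bialgebras (Tang and Sheng).
\<close>

definition leibniz_bialgebra ::
  "('k::field \<Rightarrow> 'a::ab_group_add \<Rightarrow> 'a) \<Rightarrow> ('a \<Rightarrow> 'a \<Rightarrow> 'a) \<Rightarrow> ('a \<Rightarrow> ('a, 'k) tensor2) \<Rightarrow> bool"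
where
  "leibniz_bialgebra s br \<Delta> \<longleftrightarrow>
     leibniz_algebra s UNIV br \<and>
     linear_map_on s UNIV dual_scale (tensor2_space s) \<Delta> \<and>
     leibniz_algebra dual_scale (dual_space s) (\<lambda>u v x. tensor_pairing (\<Delta> x) u v) \<and>
     (\<forall>x y. tensor_swap (tensor_map s (\<lambda>z. br z y) id (\<Delta> x)) = tensor_map s (\<lambda>z. br z x) id (\<Delta> y)) \<and>
     (\<forall>x y. \<Delta> (br x y) =
        - F_op s br y (\<Delta> x + tensor_swap (\<Delta> x))
        + tensor_map s (br x) id (\<Delta> y) + tensor_map s id (br x) (\<Delta> y))"

text \<open>
  That the triple below is a Leibniz bialgebra follows from the defining conditions and is not part
  of the definition; it is \<open>quasi_triangular_imp_leibniz_bialgebra\<close> below.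
\<close>

definition quasi_triangular_leibniz_bialgebra ::
  "('k::field \<Rightarrow> 'a::ab_group_add \<Rightarrow> 'a) \<Rightarrow> ('a \<Rightarrow> 'a \<Rightarrow> 'a) \<Rightarrow> ('a \<Rightarrow> ('a, 'k) tensor2) \<Rightarrow> bool"
where
  "quasi_triangular_leibniz_bialgebra s br \<Delta> \<longleftrightarrow>
     leibniz_algebra s UNIV br \<and>
     (\<exists>r. lybe_solution s br r \<and> (\<forall>x. F_op s br x (r - tensor_swap r) = 0) \<and> \<Delta> = coboundary s br r)"

section \<open>The definitions are adequate\<close>

lemma sum_fun_apply: "(\<Sum>i\<in>I. f i) x = (\<Sum>i\<in>I. f i x)" for f :: "'i \<Rightarrow> 'b \<Rightarrow> 'c::comm_monoid_add"
  by (induction I rule: infinite_finite_induct) auto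

lemma diff_fun_apply: "(f - g) x = f x - g x" for f g :: "'b \<Rightarrow> 'c::ab_group_add"
  by (simp add: fun_diff_def)

lemma uminus_fun_apply: "(- f) x = - f x" for f :: "'b \<Rightarrow> 'c::ab_group_add"
  by (simp add: fun_Compl_def)

lemmas fun_op_apply = sum_fun_apply diff_fun_apply uminus_fun_apply

lemma vector_space_mult: "vector_space ((*) :: 'k::field \<Rightarrow> 'k \<Rightarrow> 'k)"
  by unfold_locales (auto simp: algebra_simps)

lemma linear_formI:
  assumes "vector_space (s :: 'k::field \<Rightarrow> 'a::ab_group_add \<Rightarrow> 'a)"
    and "\<And>x y. f (x + y) = f x + f y" "\<And>c x. f (s c x) = c * f x"
  shows "Vector_Spaces.linear s (*) f"
  using assms vector_space_mult by (simp add: Vector_Spaces.linear_iff)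

lemma linear_formD:
  assumes "Vector_Spaces.linear s (*) f"
  shows "f (x + y) = f x + f y" "f (s c x) = c * f x" "f 0 = 0" "f (- x) = - f x"
    "f (x - y) = f x - f y" "f (sum g I) = (\<Sum>i\<in>I. f (g i))"
proof -
  interpret Vector_Spaces.linear s "(*)" f by fact
  show "f (x + y) = f x + f y" "f (s c x) = c * f x" "f 0 = 0" "f (- x) = - f x"
    "f (x - y) = f x - f y" "f (sum g I) = (\<Sum>i\<in>I. f (g i))"
    by (simp_all add: add scale diff neg sum)
qed

lemma dual_separates:
  assumes "vector_space (s :: 'k::field \<Rightarrow> 'a::ab_group_add \<Rightarrow> 'a)"
    and "\<And>v. v \<in> dual_space s \<Longrightarrow> v x = v y"
  shows "x = y"
proof (rule ccontr)
  assume "x \<noteq> y"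
  interpret p: vector_space_pair s "(*) :: 'k \<Rightarrow> 'k \<Rightarrow> 'k"
    unfolding vector_space_pair_def using assms(1) vector_space_mult by blast
  have "p.vs1.independent {x - y}"
    using \<open>x \<noteq> y\<close> by simp
  then obtain g where "Vector_Spaces.linear s (*) g" "g (x - y) = 1"
    using p.linear_independent_extend[of "{x - y}" "\<lambda>_. 1"] by auto
  moreover from this have "g x = g y"
    using assms(2) by (simp add: dual_space_def)
  ultimately show False
    by (simp add: linear_formD(5))
qed

lemma tensor2_sum_apply:
  "bilinear_form s \<beta> \<Longrightarrow> (\<Sum>i\<in>I. tensor2 s (a i) (b i)) \<beta> = (\<Sum>i\<in>I. \<beta> (a i) (b i))"
  "\<not> bilinear_form s \<beta> \<Longrightarrow> (\<Sum>i\<in>I. tensor2 s (a i) (b i)) \<beta> = 0"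
  by (simp_all add: sum_fun_apply tensor2_def)

lemma bilinear_form_iff:
  assumes "vector_space (s :: 'k::field \<Rightarrow> 'a::ab_group_add \<Rightarrow> 'a)"
  shows "bilinear_form s \<beta> \<longleftrightarrow>
    (\<forall>a b b'. \<beta> a (b + b') = \<beta> a b + \<beta> a b') \<and> (\<forall>a c b. \<beta> a (s c b) = c * \<beta> a b) \<and>
    (\<forall>b a a'. \<beta> (a + a') b = \<beta> a b + \<beta> a' b) \<and> (\<forall>b c a. \<beta> (s c a) b = c * \<beta> a b)"
  by (auto simp: bilinear_form_def Vector_Spaces.linear_iff assms vector_space_mult)

lemma bilinear_form_sum:
  assumes vs: "vector_space (s :: 'k::field \<Rightarrow> 'a::ab_group_add \<Rightarrow> 'a)"
    and h: "\<And>j. bilinear_form s (\<lambda>p q. h p q j)"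
  shows "bilinear_form s (\<lambda>p q. \<Sum>j\<in>J. h p q j)"
proof -
  have "h (x + y) z j = h x z j + h y z j" "h z (x + y) j = h z x j + h z y j"
    "h (s c x) z j = c * h x z j" "h z (s c x) j = c * h z x j" for x y z c j
    using h[of j] by (auto simp: bilinear_form_def Vector_Spaces.linear_iff)
  then show ?thesis
    unfolding bilinear_form_def
    by (auto intro!: linear_formI vs simp: sum.distrib sum_distrib_left)
qed

lemma bilinear_form_prod:
  assumes "u \<in> dual_space s" "v \<in> dual_space s"
  shows "bilinear_form s (\<lambda>a b. u a * v b)"
proof -
  have "vector_space s"
    using assms(1) by (simp add: dual_space_def Vector_Spaces.linear_iff)
  with assms show ?thesis
    unfolding bilinear_form_def dual_space_def
    by (auto intro!: linear_formI simp: linear_formD algebra_simps)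
qed

lemma tensor_pairing_sum:
  assumes "u \<in> dual_space s" "v \<in> dual_space s"
  shows "tensor_pairing (\<Sum>i\<in>I. tensor2 s (a i) (b i)) u v = (\<Sum>i\<in>I. u (a i) * v (b i))"
  by (simp add: tensor_pairing_def tensor2_sum_apply(1)[OF bilinear_form_prod[OF assms]])

lemma T_op_sum:
  assumes "vector_space s" "u \<in> dual_space s"
  shows "T_op s (\<Sum>i\<in>I. tensor2 s (a i) (b i)) u = (\<Sum>i\<in>I. s (u (a i)) (b i))"
  unfolding T_op_def
proof (rule the_equality)
  show *: "\<forall>v\<in>dual_space s. v (\<Sum>i\<in>I. s (u (a i)) (b i))
      = tensor_pairing (\<Sum>i\<in>I. tensor2 s (a i) (b i)) u v"
    using assms(2) by (auto simp: tensor_pairing_sum) (simp add: dual_space_def linear_formD)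
  show "x = (\<Sum>i\<in>I. s (u (a i)) (b i))"
    if "\<forall>v\<in>dual_space s. v x = tensor_pairing (\<Sum>i\<in>I. tensor2 s (a i) (b i)) u v" for x
    using that * by (intro dual_separates[OF assms(1)]) simp
qed

lemma bilinear_form_swap: "bilinear_form s (\<lambda>a b. \<beta> b a) \<longleftrightarrow> bilinear_form s \<beta>"
  by (auto simp: bilinear_form_def)

lemma tensor_swap_sum:
  "tensor_swap (\<Sum>i\<in>I. tensor2 s (a i) (b i)) = (\<Sum>i\<in>I. tensor2 s (b i) (a i))"
proof (rule ext)
  fix \<beta> :: "'a \<Rightarrow> 'a \<Rightarrow> 'b"
  show "tensor_swap (\<Sum>i\<in>I. tensor2 s (a i) (b i)) \<beta> = (\<Sum>i\<in>I. tensor2 s (b i) (a i)) \<beta>"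
    using bilinear_form_swap[of s \<beta>] by (simp add: tensor_swap_def sum_fun_apply tensor2_def)
qed

lemma bilinear_form_comp:
  assumes "bilinear_form s \<beta>" "Vector_Spaces.linear s s f" "Vector_Spaces.linear s s g"
  shows "bilinear_form s (\<lambda>a b. \<beta> (f a) (g b))"
proof -
  have "vector_space s"
    using assms(2) by (simp add: Vector_Spaces.linear_iff)
  with assms show ?thesis
    by (auto simp: bilinear_form_def Vector_Spaces.linear_iff)
qed

lemma tensor_map_sum:
  assumes "Vector_Spaces.linear s s f" "Vector_Spaces.linear s s g"
  shows "tensor_map s f g (\<Sum>i\<in>I. tensor2 s (a i) (b i)) = (\<Sum>i\<in>I. tensor2 s (f (a i)) (g (b i)))"
  using bilinear_form_comp[OF _ assms]
  by (intro ext) (simp add: tensor_map_def sum_fun_apply tensor2_def)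

lemma leibniz_algebra_linear:
  assumes "leibniz_algebra s UNIV br"
  shows "vector_space s" "Vector_Spaces.linear s s (br x)" "Vector_Spaces.linear s s (\<lambda>y. br y x)"
    "Vector_Spaces.linear s s (\<lambda>y. br x y + br y x)" "Vector_Spaces.linear s s id"
    "br x (br y z) = br (br x y) z + br y (br x z)"
proof -
  show vs: "vector_space s"
    using assms by (simp add: leibniz_algebra_def fin_dim_space_def)
  interpret vector_space s by (rule vs)
  have lin: "br (y + z) x = br y x + br z x" "br x (y + z) = br x y + br x z"
    "br (s c y) x = s c (br y x)" "br x (s c y) = s c (br x y)" for x y z c
    using assms unfolding leibniz_algebra_def bilinear_map_on_def linear_map_on_def by blast+
  show "Vector_Spaces.linear s s (br x)" "Vector_Spaces.linear s s (\<lambda>y. br y x)"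
    "Vector_Spaces.linear s s (\<lambda>y. br x y + br y x)" "Vector_Spaces.linear s s id"
    by (simp_all add: Vector_Spaces.linear_iff vs lin scale_right_distrib)
  show "br x (br y z) = br (br x y) z + br y (br x z)"
    using assms unfolding leibniz_algebra_def by blast
qed

lemma yang_baxter_unique:
  assumes "leibniz_algebra s UNIV br"
  shows "yang_baxter s br (\<Sum>i<n. tensor2 s (a i) (b i)) = yang_baxter_sum s br n a b"
proof -
  note L = leibniz_algebra_linear[OF assms]
  have lin: "br (x + y) z = br x z + br y z" "br z (x + y) = br z x + br z y"
    "br (s c x) z = s c (br x z)" "br z (s c x) = s c (br z x)" for x y z c
    using L(2,3) by (auto simp: Vector_Spaces.linear_iff)
  interpret vector_space s by (rule L)
  have key: "yang_baxter_sum s br m f g = (\<lambda>\<tau>. if trilinear_form s \<tau> then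
        r (\<lambda>p q. r (\<lambda>p' q'. \<tau> (br p p') q q' - \<tau> p (br q p' + br p' q) q' + \<tau> p p' (br q' q))) else 0)"
    if r: "r = (\<Sum>i<m. tensor2 s (f i) (g i))" for m f g r
  proof (rule ext)
    fix \<tau> :: "'b \<Rightarrow> 'b \<Rightarrow> 'b \<Rightarrow> 'a"
    show "yang_baxter_sum s br m f g \<tau> = (if trilinear_form s \<tau> then
        r (\<lambda>p q. r (\<lambda>p' q'. \<tau> (br p p') q q' - \<tau> p (br q p' + br p' q) q' + \<tau> p p' (br q' q))) else 0)"
    proof (cases "trilinear_form s \<tau>")
      case False
      then show ?thesis
        by (simp add: yang_baxter_sum_def fun_op_apply tensor3_def)
    next
      case True
      let ?h = "\<lambda>p q p' q'. \<tau> (br p p') q q' - \<tau> p (br q p' + br p' q) q' + \<tau> p p' (br q' q)"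
      have t: "\<tau> (x + y) z w = \<tau> x z w + \<tau> y z w" "\<tau> z (x + y) w = \<tau> z x w + \<tau> z y w"
        "\<tau> z w (x + y) = \<tau> z w x + \<tau> z w y" "\<tau> (s c x) z w = c * \<tau> x z w"
        "\<tau> z (s c x) w = c * \<tau> z x w" "\<tau> z w (s c x) = c * \<tau> z w x" for x y z w c
        using True by (auto simp: trilinear_form_def Vector_Spaces.linear_iff)
      have b1: "bilinear_form s (?h p q)" for p q
        by (simp add: bilinear_form_iff[OF L(1)] t lin algebra_simps)
      have b2: "bilinear_form s (\<lambda>p q. ?h p q p' q')" for p' q'
        by (simp add: bilinear_form_iff[OF L(1)] t lin algebra_simps)
      have inner: "r (?h p q) = (\<Sum>j<m. ?h p q (f j) (g j))" for p q
        unfolding r by (rule tensor2_sum_apply(1)[OF b1])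
      have b3: "bilinear_form s (\<lambda>p q. \<Sum>j<m. ?h p q (f j) (g j))"
        by (rule bilinear_form_sum[OF L(1)]) (rule b2)
      have "r (\<lambda>p q. r (?h p q)) = (\<Sum>i<m. \<Sum>j<m. ?h (f i) (g i) (f j) (g j))"
        unfolding inner unfolding r by (rule tensor2_sum_apply(1)[OF b3])
      then show ?thesis
        using True by (simp add: yang_baxter_sum_def fun_op_apply tensor3_def)
    qed
  qed
  show ?thesis
    unfolding yang_baxter_def
  proof (rule the_equality)
    show "\<exists>m f g. (\<Sum>i<n. tensor2 s (a i) (b i)) = (\<Sum>i<m. tensor2 s (f i) (g i)) \<and>
        yang_baxter_sum s br n a b = yang_baxter_sum s br m f g"
      by blast
  next
    fix t
    assume "\<exists>m f g. (\<Sum>i<n. tensor2 s (a i) (b i)) = (\<Sum>i<m. tensor2 s (f i) (g i)) \<and>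
        t = yang_baxter_sum s br m f g"
    then obtain m f g where
      eq: "(\<Sum>i<n. tensor2 s (a i) (b i)) = (\<Sum>i<m. tensor2 s (f i) (g i))"
      and t: "t = yang_baxter_sum s br m f g"
      by blast
    show "t = yang_baxter_sum s br n a b"
      unfolding t key[OF eq] key[OF refl, where m = n and f = a and g = b] ..
  qed
qed

lemma trilinear_form_prod:
  assumes "u \<in> dual_space s" "v \<in> dual_space s" "w \<in> dual_space s"
  shows "trilinear_form s (\<lambda>a b c. u a * v b * w c)"
proof -
  have "vector_space s"
    using assms(1) by (simp add: dual_space_def Vector_Spaces.linear_iff)
  with assms show ?thesis
    unfolding trilinear_form_def dual_space_def
    by (auto intro!: linear_formI simp: linear_formD algebra_simps)
qed

lemma tensor2_space_add:
  assumes "p \<in> tensor2_space s" "q \<in> tensor2_space s"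
  shows "p + q \<in> tensor2_space s"
proof -
  obtain n a b m c d where p: "p = (\<Sum>i<(n::nat). tensor2 s (a i) (b i))"
    and q: "q = (\<Sum>i<(m::nat). tensor2 s (c i) (d i))"
    using assms unfolding tensor2_space_def by blast
  define e where "e i = (if i < n then a i else c (i - n))" for i
  define f where "f i = (if i < n then b i else d (i - n))" for i
  have "(\<Sum>i<n + m. tensor2 s (e i) (f i)) =
      (\<Sum>i<n. tensor2 s (e i) (f i)) + (\<Sum>i<m. tensor2 s (e (n + i)) (f (n + i)))"
    by (induction m) (simp_all add: add.assoc)
  also have "\<dots> = p + q"
    by (simp add: p q e_def f_def)
  finally show ?thesis
    unfolding tensor2_space_def by (metis (mono_tags, lifting) mem_Collect_eq)
qed

lemma tensor2_space_uminus:
  assumes "vector_space s" "p \<in> tensor2_space s"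
  shows "- p \<in> tensor2_space s"
proof -
  obtain n a b where p: "p = (\<Sum>i<(n::nat). tensor2 s (a i) (b i))"
    using assms unfolding tensor2_space_def by blast
  have "tensor2 s (- x) y = - tensor2 s x y" for x y
    by (auto simp: fun_eq_iff tensor2_def fun_op_apply bilinear_form_def
        dest!: spec[where x = y] dest: linear_formD(4))
  then have "- p = (\<Sum>i<n. tensor2 s (- a i) (b i))"
    by (simp add: p sum_negf)
  then show ?thesis
    unfolding tensor2_space_def
    by (intro CollectI exI[of _ n] exI[of _ "\<lambda>i. - a i"] exI[of _ b])
qed

lemma vector_space_dual_scale: "vector_space (dual_scale :: 'k::field \<Rightarrow> ('a \<Rightarrow> 'k) \<Rightarrow> 'a \<Rightarrow> 'k)"
proof (rule vector_space.intro)
  fix a b :: 'k and x y :: "'a \<Rightarrow> 'k"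
  show "dual_scale a (x + y) = dual_scale a x + dual_scale a y"
    by (rule ext) (simp add: dual_scale_def distrib_left)
  show "dual_scale (a + b) x = dual_scale a x + dual_scale b x"
    by (rule ext) (simp add: dual_scale_def distrib_right)
  show "dual_scale a (dual_scale b x) = dual_scale (a * b) x"
    by (rule ext) (simp add: dual_scale_def mult.assoc)
  show "dual_scale 1 x = x"
    by (rule ext) (simp add: dual_scale_def)
qed

lemma dual_space_closed:
  assumes "vector_space s"
  shows "0 \<in> dual_space s" "u \<in> dual_space s \<Longrightarrow> v \<in> dual_space s \<Longrightarrow> u + v \<in> dual_space s"
    "u \<in> dual_space s \<Longrightarrow> dual_scale c u \<in> dual_space s"
  unfolding dual_space_def mem_Collect_eq Vector_Spaces.linear_iff
  using assms vector_space_mult by (auto simp: dual_scale_def distrib_left distrib_right mult_ac add_ac)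

lemma dual_basis:
  fixes s :: "'k::field \<Rightarrow> 'a::ab_group_add \<Rightarrow> 'a"
  assumes "fin_dim_space s UNIV"
  obtains C :: "'a set" and d where "finite C" "\<And>c. d c \<in> dual_space s"
    "\<And>u x. u \<in> dual_space s \<Longrightarrow> u x = (\<Sum>c\<in>C. u c * d c x)"
proof -
  have vs: "vector_space s"
    using assms by (simp add: fin_dim_space_def)
  interpret p: vector_space_pair s "(*)"
    unfolding vector_space_pair_def using vs vector_space_mult by blast
  obtain B where B: "finite B" "p.vs1.span B = UNIV"
    using assms unfolding fin_dim_space_def by blast
  obtain C where "C \<subseteq> B" and ind: "p.vs1.independent C" and "B \<subseteq> p.vs1.span C"
    by (rule p.vs1.maximal_independent_subset[of B])
  then have fin: "finite C" and span: "p.vs1.span C = UNIV"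
    using p.vs1.span_minimal[of B "p.vs1.span C"] p.vs1.subspace_span[of C] B finite_subset[of C B]
    by auto
  have "\<exists>g. Vector_Spaces.linear s (*) g \<and> (\<forall>x\<in>C. g x = (if x = c then 1 else 0))" for c
    by (rule p.linear_independent_extend[OF ind])
  then obtain d where d: "\<And>c. Vector_Spaces.linear s (*) (d c)"
    "\<And>c x. x \<in> C \<Longrightarrow> d c x = (if x = c then 1 else 0)"
    by metis
  have "u x = (\<Sum>c\<in>C. u c * d c x)" if u: "u \<in> dual_space s" for u x
  proof (rule p.linear_eq_on[of u _ x C])
    show "Vector_Spaces.linear s (*) u"
      using u by (simp add: dual_space_def)
    show "Vector_Spaces.linear s (*) (\<lambda>x. \<Sum>c\<in>C. u c * d c x)"
      by (rule linear_formI[OF vs])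
        (simp_all only: linear_formD(1,2)[OF d(1)] distrib_left sum.distrib sum_distrib_left mult.left_commute)
    show "x \<in> p.vs1.span C"
      by (simp add: span)
    show "u b = (\<Sum>c\<in>C. u c * d c b)" if "b \<in> C" for b
    proof -
      have "(\<Sum>c\<in>C. u c * d c b) = (\<Sum>c\<in>C. if b = c then u c else 0)"
        using that by (intro sum.cong) (auto simp: d)
      then show ?thesis
        using that fin by simp
    qed
  qed
  with fin d(1) show thesis
    by (intro that[of C d]) (auto simp: dual_space_def)
qed

lemma fin_dim_space_dual:
  fixes s :: "'k::field \<Rightarrow> 'a::ab_group_add \<Rightarrow> 'a"
  assumes "fin_dim_space s UNIV"
  shows "fin_dim_space dual_scale (dual_space s)"
proof -
  have vs: "vector_space s"
    using assms by (simp add: fin_dim_space_def)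
  obtain C :: "'a set" and d where C: "finite C" and d: "\<And>c. d c \<in> dual_space s"
    "\<And>u x. u \<in> dual_space s \<Longrightarrow> u x = (\<Sum>c\<in>C. u c * d c x)"
    by (rule dual_basis[OF assms]) blast
  interpret D: vector_space "dual_scale :: 'k \<Rightarrow> ('a \<Rightarrow> 'k) \<Rightarrow> 'a \<Rightarrow> 'k"
    by (rule vector_space_dual_scale)
  have sub: "D.subspace (dual_space s)"
    using dual_space_closed[OF vs] unfolding D.subspace_def by blast
  have "u \<in> D.span (d ` C)" if "u \<in> dual_space s" for u
  proof -
    have "u = (\<Sum>c\<in>C. dual_scale (u c) (d c))"
      unfolding fun_eq_iff sum_fun_apply dual_scale_def using d(2)[OF that] by blast
    then show ?thesis
      by (metis (no_types, lifting) D.span_sum D.span_scale D.span_base imageI)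
  qed
  then have "D.span (d ` C) = dual_space s"
    using D.span_minimal[OF _ sub, of "d ` C"] d(1) by blast
  with C sub D.vector_space_axioms show ?thesis
    unfolding fin_dim_space_def by blast
qed

lemma group_cancel_aux:
  fixes p q c t :: "'g::ab_group_add"
  assumes "p + q + c = 0" "t + c + q = 0"
  shows "p = t"
proof -
  have "p + (q + c) = t + (q + c)"
    using assms by (simp only: add.assoc add.commute[of q c])
  then show ?thesis
    by (simp only: add_right_cancel)
qed

theorem quasi_triangular_imp_leibniz_bialgebra:
  assumes "quasi_triangular_leibniz_bialgebra s br \<Delta>"
  shows "leibniz_bialgebra s br \<Delta>"
proof -
  obtain r where leib: "leibniz_algebra s UNIV br" and sol: "lybe_solution s br r"
    and inv: "\<And>x. F_op s br x (r - tensor_swap r) = 0" and \<Delta>: "\<Delta> = coboundary s br r"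
    using assms unfolding quasi_triangular_leibniz_bialgebra_def by blast
  obtain n a b where r: "r = (\<Sum>i<(n::nat). tensor2 s (a i) (b i))"
    using sol unfolding lybe_solution_def tensor2_space_def by blast
  note L = leibniz_algebra_linear[OF leib]
  note vs = L(1)
  interpret vector_space s by (rule vs)
  have lin: "br (x + y) z = br x z + br y z" "br z (x + y) = br z x + br z y"
    "br (s c x) z = s c (br x z)" "br z (s c x) = s c (br z x)" for x y z c
    using L(2,3) by (auto simp: Vector_Spaces.linear_iff)
  have lin': "br (x - y) z = br x z - br y z" "br z (x - y) = br z x - br z y" for x y z
    using lin(1)[of "x - y" y z] lin(2)[of z "x - y" y] by (simp_all add: algebra_simps)
  have lin_sum: "br (sum f I) z = (\<Sum>i\<in>I. br (f i) z)" "br z (sum f I) = (\<Sum>i\<in>I. br z (f i))"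
    for f :: "nat \<Rightarrow> 'b" and I z
    using module_hom.sum[OF Vector_Spaces.linear.axioms(3)[OF L(3)], of f I z]
      module_hom.sum[OF Vector_Spaces.linear.axioms(3)[OF L(2)], of z f I] by simp_all
  define K where "K x y = br x y + br y x" for x y
  have K: "K (x + y) z = K x z + K y z" "K z (x + y) = K z x + K z y"
    "K (s c x) z = s c (K x z)" "K z (s c x) = s c (K z x)" for x y z c
    by (simp_all add: K_def lin algebra_simps)
  have left_center: "br (K x y) z = 0" for x y z
    using L(6)[of x y z] L(6)[of y x z] by (simp add: K_def lin)
  have eval: "F_op s br x t \<beta> = t (\<lambda>p q. \<beta> (K x p) q) - t (\<lambda>p q. \<beta> p (br q x))"
    if "bilinear_form s \<beta>" for x t \<beta>
    using that by (simp add: F_op_def tensor_map_def diff_fun_apply K_def)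
  have eval0: "t \<beta> = 0" if "\<not> bilinear_form s \<beta>" "t \<in> tensor2_space s" for t \<beta>
    using that tensor2_sum_apply(2) unfolding tensor2_space_def by blast
  have reval: "r \<beta> = (\<Sum>i<n. \<beta> (a i) (b i))" if "bilinear_form s \<beta>" for \<beta>
    using that by (simp add: r tensor2_sum_apply)
  have bf: "bilinear_form s (\<lambda>p q. \<beta> (K x p) q)" "bilinear_form s (\<lambda>p q. \<beta> p (K x q))"
    "bilinear_form s (\<lambda>p q. \<beta> (br x p) q)" "bilinear_form s (\<lambda>p q. \<beta> p (br x q))"
    "bilinear_form s (\<lambda>p q. \<beta> (br p x) q)" "bilinear_form s (\<lambda>p q. \<beta> p (br q x))"
    "bilinear_form s (\<lambda>p q. \<beta> q p)"
    if "bilinear_form s \<beta>" for \<beta> x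
    using that by (simp_all add: bilinear_form_iff[OF vs] K lin)
  have Feval: "F_op s br x r \<beta> = (\<Sum>i<n. \<beta> (K x (a i)) (b i)) - (\<Sum>i<n. \<beta> (a i) (br (b i) x))"
    if "bilinear_form s \<beta>" for x \<beta>
    using that by (simp add: eval reval bf)
  have inv': "(\<Sum>i<n. \<beta> (K x (a i)) (b i)) - (\<Sum>i<n. \<beta> (a i) (br (b i) x)) =
      (\<Sum>i<n. \<beta> (K x (b i)) (a i)) - (\<Sum>i<n. \<beta> (b i) (br (a i) x))"
    if "bilinear_form s \<beta>" for x \<beta>
  proof -
    have "F_op s br x (r - tensor_swap r) \<beta> = 0"
      by (simp add: inv)
    then show ?thesis
      using that by (simp add: eval diff_fun_apply tensor_swap_def reval bf) (simp add: algebra_simps)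
  qed

  define V where "V = dual_space s"
  have V: "u (x + y) = u x + u y" "u (x - y) = u x - u y" "u (s c x) = c * u x"
    "u (sum f I) = (\<Sum>i\<in>I. u (f i))" "u 0 = 0"
    if "u \<in> V" for u x y c f and I :: "nat set"
    using that by (simp_all add: V_def dual_space_def linear_formD)
  have VI: "u \<in> V" if "\<And>x y. u (x + y) = u x + u y" "\<And>c x. u (s c x) = c * u x" for u
    using that by (simp add: V_def dual_space_def linear_formI vs)
  define T where "T u = (\<Sum>i<n. s (u (a i)) (b i))" for u
  define T' where "T' u = (\<Sum>i<n. s (u (b i)) (a i))" for u
  define S where "S u = T u - T' u" for u
  define m where "m u v x = u (K x (T' v)) - v (br (T u) x)" for u v x
  define \<rho> where "\<rho> x u z = u (K x z)" for x :: 'b and u :: "'b \<Rightarrow> 'a" and z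
  have TT': "v (T u) = u (T' v)" if "u \<in> V" "v \<in> V" for u v
    by (simp add: T_def T'_def V[OF that(1)] V[OF that(2)] mult.commute)
  have mV: "m u v \<in> V" if "u \<in> V" "v \<in> V" for u v
    by (intro VI) (simp_all add: m_def V[OF that(1)] V[OF that(2)] K lin algebra_simps)
  have \<rho>V: "\<rho> x u \<in> V" if "u \<in> V" for x u
    by (intro VI) (simp_all add: \<rho>_def V[OF that] K)
  have Ksum: "K z (sum f I) = (\<Sum>i\<in>I. K z (f i))" for z f and I :: "nat set"
    by (simp add: K_def lin_sum sum.distrib)
  have KT: "u (K x (T v)) = (\<Sum>i<n. v (a i) * u (K x (b i)))"
    "u (K x (T' v)) = (\<Sum>i<n. v (b i) * u (K x (a i)))"
    "u (br (T v) x) = (\<Sum>i<n. v (a i) * u (br (b i) x))"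
    "u (br (T' v) x) = (\<Sum>i<n. v (b i) * u (br (a i) x))" if "u \<in> V" for u v x
    by (simp_all add: T_def T'_def Ksum lin_sum V[OF that] lin K)
  have pairing: "tensor_pairing (\<Delta> x) u v = m u v x" if uv: "u \<in> V" "v \<in> V" for u v x
  proof -
    have "bilinear_form s (\<lambda>p q. u p * v q)"
      using uv bilinear_form_prod[of u s v] by (simp add: V_def)
    then show ?thesis
      by (simp add: \<Delta> coboundary_def tensor_pairing_def Feval m_def KT[OF uv(1)] KT[OF uv(2)] mult.commute)
  qed
  have Sinv: "u (K x (S v)) + v (br (S u) x) = 0" if uv: "u \<in> V" "v \<in> V" for u v x
  proof -
    have "bilinear_form s (\<lambda>p q. u p * v q)"
      using uv bilinear_form_prod[of u s v] by (simp add: V_def)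
    from inv'[OF this, of x] have "u (K x (T' v)) - v (br (T u) x) = u (K x (T v)) - v (br (T' u) x)"
      by (simp add: KT[OF uv(1)] KT[OF uv(2)] mult.commute)
    moreover have "K x (T v - T' v) = K x (T v) - K x (T' v)"
      by (simp add: K_def lin')
    ultimately show ?thesis
      by (simp add: S_def lin' V[OF uv(1)] V[OF uv(2)]) (simp add: algebra_simps)
  qed
  have S_anti: "v (S u) = - u (S v)" if "u \<in> V" "v \<in> V" for u v
    by (simp add: S_def V[OF that(1)] V[OF that(2)] TT'[OF that] TT'[OF that(2,1)])
  have sep: "x = y" if "\<And>w. w \<in> V \<Longrightarrow> w x = w y" for x y
    using dual_separates[OF vs] that by (simp add: V_def)
  have yb: "w (br (T u) (T v)) = u (K (T v) (T' w)) - v (br (T' u) (T' w))"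
    if uvw: "u \<in> V" "v \<in> V" "w \<in> V" for u v w
  proof -
    have "yang_baxter_sum s br n a b (\<lambda>x y z. v x * u y * w z) = 0"
      using sol yang_baxter_unique[OF leib, of a b n] by (simp add: lybe_solution_def r)
    moreover have "w (br (T u) (T v)) = (\<Sum>i<n. \<Sum>j<n. v (a i) * u (a j) * w (br (b j) (b i)))"
      unfolding KT[OF uvw(3)] unfolding T_def lin_sum V(4)[OF uvw(3)] lin V(3)[OF uvw(3)]
      by (subst sum.swap) (simp add: sum_distrib_left mult_ac)
    moreover have "u (K (T v) (T' w)) =
        (\<Sum>i<n. \<Sum>j<n. v (a i) * u (br (b i) (a j) + br (a j) (b i)) * w (b j))"
    proof -
      have sym: "K x y = br y x + br x y" for x y
        by (simp add: K_def add.commute)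
      show ?thesis
        unfolding KT[OF uvw(1)] unfolding sym[of "T v"] lin_sum V(1)[OF uvw(1)] KT[OF uvw(1)]
        unfolding T_def lin_sum V(4)[OF uvw(1)] lin V(3)[OF uvw(1)]
        by (subst sum.swap) (simp add: sum_distrib_left distrib_left distrib_right
          mult_ac add_ac V(1)[OF uvw(1)] sum.distrib)
    qed
    moreover have "v (br (T' u) (T' w)) = (\<Sum>i<n. \<Sum>j<n. v (br (a i) (a j)) * u (b i) * w (b j))"
      unfolding KT[OF uvw(2)] unfolding T'_def lin_sum V(4)[OF uvw(2)] lin V(3)[OF uvw(2)]
      by (simp add: sum_distrib_left mult_ac)
    ultimately show ?thesis
      using trilinear_form_prod[of v s u w] uvw
      by (simp add: yang_baxter_sum_def fun_op_apply tensor3_def V_def[symmetric]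
          sum.distrib sum_subtractf algebra_simps)
  qed
  have Tm: "T (m u v) = br (T u) (T v)" if uv: "u \<in> V" "v \<in> V" for u v
  proof (rule sep)
    fix w assume w: "w \<in> V"
    have "T x = T' x + S x" for x
      by (simp add: S_def)
    then have "w (br (T u) (T v)) - w (T (m u v)) = u (K (S v) (T' w)) + v (br (S u) (T' w))"
      unfolding yb[OF uv w] TT'[OF mV[OF uv] w]
      by (simp add: m_def K_def V[OF uv(1)] V[OF uv(2)] lin lin' S_def)
    also have "\<dots> = 0"
      using Sinv[OF uv, of "T' w"] by (simp add: K_def add.commute)
    finally show "w (T (m u v)) = w (br (T u) (T v))"
      by simp
  qed
  have S\<rho>: "S (\<rho> x u) = br (S u) x" if "u \<in> V" for u x
  proof (rule sep)
    fix w assume w: "w \<in> V"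
    show "w (S (\<rho> x u)) = w (br (S u) x)"
      using S_anti[OF \<rho>V[OF that] w, of x] Sinv[OF that w, of x]
      by (simp add: \<rho>_def add_eq_0_iff)
  qed
  have T'm: "T' (m u v) = br (T' u) (T' v)" if uv: "u \<in> V" "v \<in> V" for u v
  proof (rule sep)
    fix w assume w: "w \<in> V"
    have "w (S (m u v)) = - m u v (S w)"
      by (rule S_anti[OF mV[OF uv] w])
    also have "\<dots> = v (br (T u) (S w)) - u (K (T' v) (S w))"
      by (simp add: m_def K_def add.commute)
    also have "u (K (T' v) (S w)) = - w (br (S u) (T' v))"
      using Sinv[OF uv(1) w, of "T' v"] by (simp add: eq_neg_iff_add_eq_0)
    also have "v (br (T u) (S w)) = w (br (T u) (S v))"
    proof -
      have "v (br (T u) (S w)) + v (br (S w) (T u)) + w (br (S v) (T u)) = 0"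
        "w (br (T u) (S v)) + w (br (S v) (T u)) + v (br (S w) (T u)) = 0"
        using Sinv[OF uv(2) w, of "T u"] Sinv[OF w uv(2), of "T u"]
        by (simp_all add: K_def V[OF uv(2)] V[OF w])
      then show ?thesis
        by (rule group_cancel_aux)
    qed
    finally have "w (S (m u v)) = w (br (T u) (S v)) + w (br (S u) (T' v))"
      by simp
    moreover have "w (T' (m u v)) = w (br (T u) (T v)) - w (S (m u v))"
      by (simp add: S_def V[OF w] Tm[OF uv])
    moreover have "br (T u) (S v) = br (T u) (T v) - br (T u) (T' v)"
      "br (S u) (T' v) = br (T u) (T' v) - br (T' u) (T' v)"
      by (simp_all add: S_def lin')
    ultimately show "w (T' (m u v)) = w (br (T' u) (T' v))"
      by (simp add: V[OF w])
  qed
  have m_leibniz: "m u (m v w) z = m (m u v) w z + m v (m u w) z"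
    if uvw: "u \<in> V" "v \<in> V" "w \<in> V" for u v w z
  proof -
    note Vs = V[OF uvw(1)] V[OF uvw(2)] V[OF uvw(3)]
    have 1: "v (K z (br (S u) (T' w))) + u (K (T' w) (br (S v) z)) = 0"
      using Sinv[OF uvw(2) \<rho>V[OF uvw(1)], of z "T' w"] by (simp add: S\<rho>[OF uvw(1)] \<rho>_def)
    have "K z (br (S u) (T' w)) = br (S u) (K (T' w) z) - K (T' w) (br (S u) z)"
      by (simp add: K_def lin L(6)[of "S u"])
    with 1 have 2: "v (br (S u) (K (T' w) z)) - v (K (T' w) (br (S u) z)) +
        u (K (T' w) (br (S v) z)) = 0"
      by (simp add: Vs)
    have T: "T x = T' x + S x" for x
      by (simp add: S_def)
    have 3: "br (T' x) (K (T' w) z) = K (T' w) (br (T' x) z) + K z (br (T' x) (T' w))" for x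
      by (simp add: K_def lin L(6)[of "T' x"])
    have 4: "w (br (T u) (br (T v) z)) = w (br (br (T u) (T v)) z) + w (br (T v) (br (T u) z))"
      using L(6)[of "T u" "T v" z] by (simp add: Vs)
    have 5: "u (K z (br (T' v) (T' w))) + u (K (T' w) (br (T' v) z)) - u (K (K (T' w) z) (T' v)) = 0"
      using 3[of v] left_center[of "T' w" z "T' v"] by (simp add: K_def[of "K (T' w) z"] Vs)
    have 6: "v (br (T' u) (K (T' w) z)) = v (K (T' w) (br (T' u) z)) + v (K z (br (T' u) (T' w)))"
      using 3[of u] by (simp add: Vs)
    have sym: "K x y = K y x" for x y
      by (simp add: K_def add.commute)
    have M1: "m u (m v w) z = u (K z (br (T' v) (T' w))) - v (K (T' w) (br (T u) z)) + w (br (T v) (br (T u) z))"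
      unfolding sym[of "T' w"] by (simp add: m_def[of u] T'm uvw) (simp add: m_def)
    have M2: "m v (m u w) z = v (K z (br (T' u) (T' w))) - u (K (T' w) (br (T v) z)) + w (br (T u) (br (T v) z))"
      unfolding sym[of "T' w"] by (simp add: m_def[of v] T'm uvw) (simp add: m_def)
    have M3: "m (m u v) w z = u (K (K (T' w) z) (T' v)) - v (br (T u) (K (T' w) z)) - w (br (br (T u) (T v)) z)"
      unfolding sym[of "T' w"] by (simp add: m_def[of "m u v"] Tm uvw) (simp add: m_def)
    have 7: "v (br (T u) (K (T' w) z)) = v (br (T' u) (K (T' w) z)) + v (br (S u) (K (T' w) z))"
      "v (K (T' w) (br (T u) z)) = v (K (T' w) (br (T' u) z)) + v (K (T' w) (br (S u) z))"
      "u (K (T' w) (br (T v) z)) = u (K (T' w) (br (T' v) z)) + u (K (T' w) (br (S v) z))"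
      by (simp_all add: T lin K Vs)
    have d2: "v (br (S u) (K (T' w) z)) = v (K (T' w) (br (S u) z)) - u (K (T' w) (br (S v) z))"
      using 2 by (simp add: algebra_simps)
    have d5: "u (K (K (T' w) z) (T' v)) = u (K z (br (T' v) (T' w))) + u (K (T' w) (br (T' v) z))"
      using 5 by simp
    show ?thesis
      unfolding M1 M2 M3 4 7 6 d2 d5 by (simp add: algebra_simps)
  qed

  have \<Delta>_space: "\<Delta> x \<in> tensor2_space s" for x
  proof -
    have eq: "\<Delta> x = (\<Sum>i<n. tensor2 s (K x (a i)) (b i)) + - (\<Sum>i<n. tensor2 s (a i) (br (b i) x))"
      by (simp add: \<Delta> coboundary_def F_op_def r tensor_map_sum L K_def)
    have mem: "(\<Sum>i<n. tensor2 s (f i) (g i)) \<in> tensor2_space s" for f g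
      unfolding tensor2_space_def by blast
    show ?thesis
      unfolding eq by (intro tensor2_space_add tensor2_space_uminus vs mem)
  qed
  have \<Delta>eval: "\<Delta> x \<beta> = (\<Sum>i<n. \<beta> (K x (a i)) (b i)) - (\<Sum>i<n. \<beta> (a i) (br (b i) x))"
    if "bilinear_form s \<beta>" for x \<beta>
    using Feval[OF that] by (simp add: \<Delta> coboundary_def)
  have \<Delta>_linear: "linear_map_on s UNIV dual_scale (tensor2_space s) \<Delta>"
    unfolding linear_map_on_def
  proof (intro conjI ballI allI ext)
    fix x y c and \<beta> :: "'b \<Rightarrow> 'b \<Rightarrow> 'a"
    show "\<Delta> x \<in> tensor2_space s" by (rule \<Delta>_space)
    show "\<Delta> (x + y) \<beta> = (\<Delta> x + \<Delta> y) \<beta>"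
      by (cases "bilinear_form s \<beta>")
        (simp_all add: \<Delta>eval eval0[OF _ \<Delta>_space] K lin bilinear_form_iff[OF vs] sum.distrib)
    show "\<Delta> (s c x) \<beta> = dual_scale c (\<Delta> x) \<beta>"
      by (cases "bilinear_form s \<beta>")
        (simp_all add: \<Delta>eval eval0[OF _ \<Delta>_space] K lin bilinear_form_iff[OF vs] dual_scale_def
          sum_distrib_left right_diff_distrib)
  qed
  have dual: "leibniz_algebra dual_scale V (\<lambda>u v x. tensor_pairing (\<Delta> x) u v)"
    unfolding leibniz_algebra_def
  proof (intro conjI ballI)
    show "fin_dim_space dual_scale V"
      using leib fin_dim_space_dual unfolding leibniz_algebra_def V_def by blast
    have D: "u + v \<in> V" "dual_scale c u \<in> V" if "u \<in> V" "v \<in> V" for u v c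
      by (intro VI; simp add: V[OF that(1)] V[OF that(2)] dual_scale_def algebra_simps)+
    have pr: "(\<lambda>x. tensor_pairing (\<Delta> x) u v) = m u v" if "u \<in> V" "v \<in> V" for u v
      using that by (simp add: pairing)
    have T'lin: "T' (u + v) = T' u + T' v" "T' (dual_scale c u) = s c (T' u)"
      "T (u + v) = T u + T v" "T (dual_scale c u) = s c (T u)" for u v c
      by (simp_all add: T_def T'_def dual_scale_def scale_left_distrib sum.distrib scale_sum_right)
    have dual_scale_apply: "dual_scale c f x = c * f x" for c x and f :: "'b \<Rightarrow> 'a"
      by (simp add: dual_scale_def)
    have mlin: "m (u + u') v = m u v + m u' v" "m v (u + u') = m v u + m v u'"
      "m (dual_scale c u) v = dual_scale c (m u v)" "m v (dual_scale c u) = dual_scale c (m v u)"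
      if "u \<in> V" "u' \<in> V" "v \<in> V" for u u' v c
      by (rule ext, simp add: m_def T'lin K lin V[OF that(1)] V[OF that(2)] V[OF that(3)]
          dual_scale_apply algebra_simps)+
    show "bilinear_map_on dual_scale V dual_scale V dual_scale V (\<lambda>u v x. tensor_pairing (\<Delta> x) u v)"
      unfolding bilinear_map_on_def linear_map_on_def
    proof (intro conjI ballI allI)
      fix u v u' c assume uv: "u \<in> V" "v \<in> V" "u' \<in> V"
      note simps = pr[OF uv(1,2)] pr[OF uv(1,3)] pr[OF uv(3,2)] pr[OF D(1)[OF uv(1,3)] uv(2)]
        pr[OF uv(1) D(1)[OF uv(2,3)]] pr[OF D(2)[OF uv(1,1)] uv(2)] pr[OF uv(1) D(2)[OF uv(2,2)]]
      show "(\<lambda>x. tensor_pairing (\<Delta> x) u v) \<in> V"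
        unfolding simps by (rule mV[OF uv(1,2)])
      then show "(\<lambda>x. tensor_pairing (\<Delta> x) u v) \<in> V" .
      show "(\<lambda>x. tensor_pairing (\<Delta> x) u (v + u')) =
          (\<lambda>x. tensor_pairing (\<Delta> x) u v) + (\<lambda>x. tensor_pairing (\<Delta> x) u u')"
        unfolding simps by (rule mlin(2)[OF uv(2,3,1)])
      show "(\<lambda>x. tensor_pairing (\<Delta> x) u (dual_scale c v)) = dual_scale c (\<lambda>x. tensor_pairing (\<Delta> x) u v)"
        unfolding simps by (rule mlin(4)[OF uv(2,2,1)])
      show "(\<lambda>x. tensor_pairing (\<Delta> x) (u + u') v) =
          (\<lambda>x. tensor_pairing (\<Delta> x) u v) + (\<lambda>x. tensor_pairing (\<Delta> x) u' v)"
        unfolding simps by (rule mlin(1)[OF uv(1,3,2)])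
      show "(\<lambda>x. tensor_pairing (\<Delta> x) (dual_scale c u) v) = dual_scale c (\<lambda>x. tensor_pairing (\<Delta> x) u v)"
        unfolding simps by (rule mlin(3)[OF uv(1,1,2)])
    qed
    fix u v w assume uvw: "u \<in> V" "v \<in> V" "w \<in> V"
    show "(\<lambda>x. tensor_pairing (\<Delta> x) u (\<lambda>x. tensor_pairing (\<Delta> x) v w)) =
        (\<lambda>x. tensor_pairing (\<Delta> x) (\<lambda>x. tensor_pairing (\<Delta> x) u v) w) +
        (\<lambda>x. tensor_pairing (\<Delta> x) v (\<lambda>x. tensor_pairing (\<Delta> x) u w))"
      unfolding pr[OF uvw(1,2)] pr[OF uvw(2,3)] pr[OF uvw(1,3)]
        pr[OF uvw(1) mV[OF uvw(2,3)]] pr[OF mV[OF uvw(1,2)] uvw(3)] pr[OF uvw(2) mV[OF uvw(1,3)]]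
      by (rule ext) (simp add: m_leibniz[OF uvw])
  qed
  have bsum: "\<beta> 0 y = 0" "\<beta> y 0 = 0" if "bilinear_form s \<beta>" for \<beta> y
    using that linear_formD(3)[of s "\<lambda>x. \<beta> x y"] linear_formD(3)[of s "\<beta> y"]
    by (auto simp: bilinear_form_def)
  have compat1: "tensor_swap (tensor_map s (\<lambda>z. br z y) id (\<Delta> x)) = tensor_map s (\<lambda>z. br z x) id (\<Delta> y)"
    for x y
  proof (rule ext)
    fix \<beta> :: "'b \<Rightarrow> 'b \<Rightarrow> 'a"
    show "tensor_swap (tensor_map s (\<lambda>z. br z y) id (\<Delta> x)) \<beta> = tensor_map s (\<lambda>z. br z x) id (\<Delta> y) \<beta>"
    proof (cases "bilinear_form s \<beta>")
      case False
      then show ?thesis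
        using bilinear_form_swap[of s \<beta>] by (simp add: tensor_swap_def tensor_map_def)
    next
      case True
      have "(\<Sum>i<n. \<beta> (br (a i) x) (br (b i) y)) = (\<Sum>i<n. \<beta> (br (b i) x) (br (a i) y))"
        using inv'[OF bf(5)[OF True, of x], of y] by (simp add: left_center bsum[OF True])
      moreover have "bilinear_form s (\<lambda>p q. \<beta> q (br p y))"
        by (rule bf(7)[OF bf(6)[OF True]])
      ultimately show ?thesis
        using bf(7)[OF True] bf(5)[OF True, of x]
        by (simp add: tensor_swap_def tensor_map_def \<Delta>eval left_center bsum[OF True] True)
    qed
  qed
  have compat2: "\<Delta> (br x y) = - F_op s br y (\<Delta> x + tensor_swap (\<Delta> x))
        + tensor_map s (br x) id (\<Delta> y) + tensor_map s id (br x) (\<Delta> y)" for x y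
  proof (rule ext)
    fix \<beta> :: "'b \<Rightarrow> 'b \<Rightarrow> 'a"
    show "\<Delta> (br x y) \<beta> = (- F_op s br y (\<Delta> x + tensor_swap (\<Delta> x))
        + tensor_map s (br x) id (\<Delta> y) + tensor_map s id (br x) (\<Delta> y)) \<beta>"
    proof (cases "bilinear_form s \<beta>")
      case False
      then show ?thesis
        using eval0[OF False \<Delta>_space]
        by (simp add: F_op_def tensor_map_def fun_op_apply)
    next
      case True
      have G: "\<Delta> x \<gamma> + tensor_swap (\<Delta> x) \<gamma> =
          (\<Sum>i<n. \<gamma> (br x (a i)) (b i)) + (\<Sum>i<n. \<gamma> (a i) (br x (b i)))"
        if "bilinear_form s \<gamma>" for \<gamma>
      proof -
        have add: "\<gamma> (p + q) z = \<gamma> p z + \<gamma> q z" "\<gamma> z (p + q) = \<gamma> z p + \<gamma> z q" for p q z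
          using that by (simp_all add: bilinear_form_iff[OF vs])
        show ?thesis
          using inv'[OF bf(7)[OF that], of x] that bf(7)[OF that]
          by (simp add: \<Delta>eval tensor_swap_def) (simp add: K_def add sum.distrib algebra_simps)
      qed
      have add: "\<beta> (p + q) z = \<beta> p z + \<beta> q z" "\<beta> z (p + q) = \<beta> z p + \<beta> z q" for p q z
        using True by (simp_all add: bilinear_form_iff[OF vs])
      have k: "br x (K y p) = K (br x y) p + K y (br x p)" for p
        by (simp add: K_def lin L(6)[of x])
      have l: "br x (br p y) = br (br x p) y + br p (br x y)" for p
        by (rule L(6))
      have "(- F_op s br y (\<Delta> x + tensor_swap (\<Delta> x)) + tensor_map s (br x) id (\<Delta> y)
            + tensor_map s id (br x) (\<Delta> y)) \<beta> =
          - ((\<Delta> x (\<lambda>p q. \<beta> (K y p) q) + tensor_swap (\<Delta> x) (\<lambda>p q. \<beta> (K y p) q))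
            - (\<Delta> x (\<lambda>p q. \<beta> p (br q y)) + tensor_swap (\<Delta> x) (\<lambda>p q. \<beta> p (br q y))))
          + \<Delta> y (\<lambda>p q. \<beta> (br x p) q) + \<Delta> y (\<lambda>p q. \<beta> p (br x q))"
        using True by (simp add: fun_op_apply eval tensor_map_def)
      also have "\<dots> = \<Delta> (br x y) \<beta>"
        unfolding G[OF bf(1)[OF True]] G[OF bf(6)[OF True]] \<Delta>eval[OF bf(3)[OF True]]
          \<Delta>eval[OF bf(4)[OF True]] \<Delta>eval[OF True] k l add sum.distrib
        by (simp add: algebra_simps)
      finally show ?thesis ..
    qed
  qed
  show ?thesis
    unfolding leibniz_bialgebra_def
    using leib \<Delta>_linear dual compat1 compat2 unfolding V_def by blast
qed

end

theory Submission
  imports Defs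
begin

text \<open>
  Pairing \<open>[[r,r]]\<close> with \<open>v \<otimes> u \<otimes> w\<close> gives \<open>\<langle>w, [T u, T v]\<rangle> - \<langle>u, [T v, T' w] + [T' w, T v]\<rangle> + \<langle>v, [T' u, T' w]\<rangle>\<close>,
  where \<open>T = T\<^sub>r\<close> and \<open>T' = T\<^bsub>\<sigma>(r)\<^esub>\<close> is its adjoint.  Since \<open>T\<^bsub>r-\<sigma>(r)\<^esub> = T - T'\<close>, this is the
  Rota-Baxter identity at \<open>(u, v)\<close> paired with \<open>w\<close>, and such pairings determine a threefold tensor.
  The invariance of the skew tensor \<open>r - \<sigma>(r)\<close> makes \<open>T\<^bsub>r-\<sigma>(r)\<^esub>\<close> equivariant from the dual
  representation to the adjoint one, which is what makes the induced product on the dual an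
  \<open>A\<close>-Leibniz algebra.
\<close>

section \<open>The operator of a tensor\<close>

text \<open>\<open>T_op\<close> is a definite description; for a sum of pure tensors the explicit
  value from \<open>T_op_sum\<close> shows that the described element exists and has its defining
  property.\<close>

lemma T_op_pairing:
  assumes "vector_space s" "t \<in> tensor2_space s" "u \<in> dual_space s" "v \<in> dual_space s"
  shows "v (T_op s t u) = tensor_pairing t u v"
proof -
  obtain n a b where t: "t = (\<Sum>i<(n::nat). tensor2 s (a i) (b i))"
    using assms(2) unfolding tensor2_space_def by blast
  have "Vector_Spaces.linear s (*) v"
    using assms(4) by (simp add: dual_space_def)
  then show ?thesis
    by (simp add: t T_op_sum assms tensor_pairing_sum linear_formD)
qed

lemma tensor2_space_swap:
  "t \<in> tensor2_space s \<Longrightarrow> tensor_swap t \<in> tensor2_space s"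
  unfolding tensor2_space_def using tensor_swap_sum by blast

lemma tensor2_space_diff:
  assumes "vector_space s" "p \<in> tensor2_space s" "q \<in> tensor2_space s"
  shows "p - q \<in> tensor2_space s"
  using tensor2_space_add[OF assms(2) tensor2_space_uminus[OF assms(1,3)]] by simp

text \<open>Exchanging the tensor legs exchanges the arguments of the pairing, so the swapped tensor
  induces the transpose.\<close>

lemma T_op_adjoint:
  assumes "vector_space s" "t \<in> tensor2_space s" "u \<in> dual_space s" "v \<in> dual_space s"
  shows "v (T_op s t u) = u (T_op s (tensor_swap t) v)"
  using assms tensor2_space_swap[OF assms(2)]
  by (simp add: T_op_pairing) (simp add: tensor_pairing_def tensor_swap_def mult.commute)

lemma T_op_diff:
  assumes "vector_space s" "p \<in> tensor2_space s" "q \<in> tensor2_space s" "u \<in> dual_space s"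
  shows "T_op s (p - q) u = T_op s p u - T_op s q u"
proof (rule dual_separates[OF assms(1)])
  fix v assume v: "v \<in> dual_space s"
  then have "Vector_Spaces.linear s (*) v"
    by (simp add: dual_space_def)
  then show "v (T_op s (p - q) u) = v (T_op s p u - T_op s q u)"
    using assms v tensor2_space_diff[OF assms(1-3)]
    by (simp add: linear_formD T_op_pairing) (simp add: tensor_pairing_def fun_op_apply)
qed

lemma T_op_linear:
  assumes "vector_space s" "t \<in> tensor2_space s"
  shows "linear_map_on dual_scale (dual_space s) s UNIV (T_op s t)"
proof -
  interpret vector_space s by fact
  obtain n a b where t: "t = (\<Sum>i<(n::nat). tensor2 s (a i) (b i))"
    using assms(2) unfolding tensor2_space_def by blast
  show ?thesis
    unfolding linear_map_on_def
    using dual_space_closed[OF assms(1)]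
    by (auto simp: t T_op_sum assms(1))
      (auto simp: dual_scale_def scale_left_distrib sum.distrib scale_sum_right)
qed

section \<open>Threefold tensors\<close>

text \<open>With two slots fixed, a trilinear form is a functional in the third, so the expansion of
  functionals applies to one slot after another.\<close>

lemma trilinear_form_expansion:
  assumes "trilinear_form s \<tau>"
    and D: "\<And>u x. u \<in> dual_space s \<Longrightarrow> u x = (\<Sum>c\<in>C. u c * D c x)"
  shows "\<tau> x y z = (\<Sum>c\<in>C. \<Sum>d\<in>C. \<Sum>e\<in>C. \<tau> c d e * (D c x * D d y * D e z))"
proof -
  have 1: "\<tau> x y z = (\<Sum>c\<in>C. \<tau> c y z * D c x)"
    using D[of "\<lambda>x. \<tau> x y z" x] assms(1) by (simp add: trilinear_form_def dual_space_def)
  have 2: "\<tau> c y z = (\<Sum>d\<in>C. \<tau> c d z * D d y)" for c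
    using D[of "\<lambda>y. \<tau> c y z" y] assms(1) by (simp add: trilinear_form_def dual_space_def)
  have 3: "\<tau> c d z = (\<Sum>e\<in>C. \<tau> c d e * D e z)" for c d
    using D[of "\<lambda>z. \<tau> c d z" z] assms(1) by (simp add: trilinear_form_def dual_space_def)
  have "\<tau> x y z = (\<Sum>c\<in>C. (\<Sum>d\<in>C. \<tau> c d z * D d y) * D c x)"
    by (subst 1) (simp only: 2)
  also have "\<dots> = (\<Sum>c\<in>C. (\<Sum>d\<in>C. (\<Sum>e\<in>C. \<tau> c d e * D e z) * D d y) * D c x)"
    by (simp only: 3)
  finally show ?thesis
    by (simp add: sum_distrib_left sum_distrib_right mult_ac)
qed

text \<open>A dual basis writes a trilinear form as a finite combination of products of functionals.
  Linearity of \<open>E\<close> is asked on all functions, so \<open>E\<close> passes through the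
  expansion without any check that partial sums are trilinear.\<close>

lemma functional_eq_0_if_products:
  fixes E :: "('a::ab_group_add \<Rightarrow> 'a \<Rightarrow> 'a \<Rightarrow> 'k::field) \<Rightarrow> 'k"
  assumes fd: "fin_dim_space s UNIV"
    and add: "\<And>f g. E (\<lambda>x y z. f x y z + g x y z) = E f + E g"
    and scale: "\<And>c f. E (\<lambda>x y z. c * f x y z) = c * E f"
    and prod: "\<And>u v w. u \<in> dual_space s \<Longrightarrow> v \<in> dual_space s \<Longrightarrow> w \<in> dual_space s \<Longrightarrow>
      E (\<lambda>x y z. u x * v y * w z) = 0"
    and \<tau>: "trilinear_form s \<tau>"
  shows "E \<tau> = 0"
proof -
  obtain C :: "'a set" and D where D: "\<And>c. D c \<in> dual_space s"
    "\<And>u x. u \<in> dual_space s \<Longrightarrow> u x = (\<Sum>c\<in>C. u c * D c x)"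
    by (rule dual_basis[OF fd]) blast
  \<comment> \<open>The scalar 0 shows that \<open>E\<close> vanishes at the zero function. This
    settles the empty sum and the sum over an infinite set, which is 0 by convention.\<close>
  have sum: "E (\<lambda>x y z. \<Sum>i\<in>I. f i x y z) = (\<Sum>i\<in>I. E (f i))" for f and I :: "'a set"
    using scale[of 0] by (induction I rule: infinite_finite_induct) (simp_all add: add)
  have "E \<tau> = E (\<lambda>x y z. \<Sum>c\<in>C. \<Sum>d\<in>C. \<Sum>e\<in>C. \<tau> c d e * (D c x * D d y * D e z))"
    by (intro arg_cong[where f = E] ext trilinear_form_expansion[OF \<tau> D(2)])
  then show ?thesis
    by (simp only: sum scale prod[OF D(1) D(1) D(1)] mult_zero_right sum.neutral_const)
qed

lemma yang_baxter_sum_eq_0_iff: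
  fixes s :: "'k::field \<Rightarrow> 'a::ab_group_add \<Rightarrow> 'a"
  assumes "fin_dim_space s UNIV"
  shows "yang_baxter_sum s br n a b = 0 \<longleftrightarrow>
    (\<forall>u\<in>dual_space s. \<forall>v\<in>dual_space s. \<forall>w\<in>dual_space s.
      yang_baxter_sum s br n a b (\<lambda>x y z. u x * v y * w z) = 0)" (is "?Y = 0 \<longleftrightarrow> ?R")
proof
  assume R: ?R
  \<comment> \<open>The same evaluation without the cut-off to 0 off the trilinear forms; only this
    version is linear on all functions.\<close>
  define E :: "('a \<Rightarrow> 'a \<Rightarrow> 'a \<Rightarrow> 'k) \<Rightarrow> 'k" where "E \<tau> = (\<Sum>i<n. \<Sum>j<n. \<tau> (br (a i) (a j)) (b i) (b j)
     - \<tau> (a i) (br (b i) (a j) + br (a j) (b i)) (b j) + \<tau> (a i) (a j) (br (b j) (b i)))" for \<tau>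
  have eval: "?Y \<tau> = (if trilinear_form s \<tau> then E \<tau> else 0)" for \<tau>
    by (simp add: yang_baxter_sum_def fun_op_apply tensor3_def E_def)
  have add: "E (\<lambda>x y z. f x y z + g x y z) = E f + E g" for f g
    by (simp add: E_def sum.distrib sum_subtractf)
  have scale: "E (\<lambda>x y z. c * f x y z) = c * E f" for c f
    by (simp add: E_def sum_distrib_left distrib_left right_diff_distrib)
  have prod: "E (\<lambda>x y z. u x * v y * w z) = 0"
    if "u \<in> dual_space s" "v \<in> dual_space s" "w \<in> dual_space s" for u v w
    using R[rule_format, OF that] trilinear_form_prod[OF that] by (simp only: eval if_True)
  have "E \<tau> = 0" if "trilinear_form s \<tau>" for \<tau>
    by (rule functional_eq_0_if_products[where E = E, OF assms add scale prod that])
  then show "?Y = 0"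
    unfolding fun_eq_iff eval zero_fun_apply by simp
next
  assume "?Y = 0"
  then show ?R
    by simp
qed

section \<open>Leibniz algebras and invariant tensors\<close>

locale leibniz =
  fixes s :: "'k::field \<Rightarrow> 'a::ab_group_add \<Rightarrow> 'a" and br :: "'a \<Rightarrow> 'a \<Rightarrow> 'a"
  assumes leib: "leibniz_algebra s UNIV br"
begin

text \<open>The symmetrised bracket: \<open>K x\<close> is the operator that \<open>F_op\<close>
  applies to the first tensor leg.\<close>

definition K :: "'a \<Rightarrow> 'a \<Rightarrow> 'a" where
  "K x y = br x y + br y x"

lemmas vs = leibniz_algebra_linear(1)[OF leib]
  and br_linear = leibniz_algebra_linear(2,3)[OF leib]
  and leibniz_identity = leibniz_algebra_linear(6)[OF leib]

sublocale vector_space s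
  by (rule vs)

lemma fin_dim: "fin_dim_space s UNIV"
  using leib by (simp add: leibniz_algebra_def)

lemma br_simps:
  "br (x + y) z = br x z + br y z" "br z (x + y) = br z x + br z y"
  "br (s c x) z = s c (br x z)" "br z (s c x) = s c (br z x)"
  "br (x - y) z = br x z - br y z" "br z (x - y) = br z x - br z y"
  "br (sum f I) z = (\<Sum>i\<in>I. br (f i) z)" "br z (sum f I) = (\<Sum>i\<in>I. br z (f i))"
proof -
  show add: "br (x + y) z = br x z + br y z" "br z (x + y) = br z x + br z y" for x y z
    using br_linear by (auto simp: Vector_Spaces.linear_iff)
  show "br (s c x) z = s c (br x z)" "br z (s c x) = s c (br z x)"
    using br_linear by (auto simp: Vector_Spaces.linear_iff)
  show "br (x - y) z = br x z - br y z" "br z (x - y) = br z x - br z y"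
    using add(1)[of "x - y" y z] add(2)[of z "x - y" y] by (simp_all add: algebra_simps)
  show "br (sum f I) z = (\<Sum>i\<in>I. br (f i) z)" "br z (sum f I) = (\<Sum>i\<in>I. br z (f i))"
    using module_hom.sum[OF Vector_Spaces.linear.axioms(3)[OF br_linear(2)], of f I z]
      module_hom.sum[OF Vector_Spaces.linear.axioms(3)[OF br_linear(1)], of z f I] by simp_all
qed

lemma K_simps:
  "K (x + y) z = K x z + K y z" "K z (x + y) = K z x + K z y"
  "K (s c x) z = s c (K x z)" "K z (s c x) = s c (K z x)"
  "K (sum f I) z = (\<Sum>i\<in>I. K (f i) z)" "K z (sum f I) = (\<Sum>i\<in>I. K z (f i))"
  by (simp_all add: K_def br_simps sum.distrib algebra_simps)

text \<open>Adding the Leibniz identities for \<open>x, y\<close> and for \<open>y, x\<close>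
  cancels everything else: left multiplication turns brackets into commutators and so kills
  symmetrised brackets.\<close>

lemma left_center: "br (K x y) z = 0"
  using leibniz_identity[of x y z] leibniz_identity[of y x z] by (simp add: K_def br_simps)

lemma K_derivation: "br x (K y z) = K (br x y) z + K y (br x z)"
  by (simp add: K_def br_simps leibniz_identity[of x])

lemma dualD:
  assumes "u \<in> dual_space s"
  shows "u (x + y) = u x + u y" "u (x - y) = u x - u y" "u (s c x) = c * u x"
    "u (- x) = - u x" "u (sum f I) = (\<Sum>i\<in>I. u (f i))" "u 0 = 0"
  using assms by (simp_all add: dual_space_def linear_formD)

lemma dualI:
  assumes "\<And>x y. u (x + y) = u x + u y" "\<And>c x. u (s c x) = c * u x"
  shows "u \<in> dual_space s"
  using assms by (simp add: dual_space_def linear_formI vs)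

section \<open>The coadjoint representation on the dual\<close>

lemma L_dual_apply: "L_dual br x u z = - u (br x z)"
  by (simp add: L_dual_def dual_rep_def)

text \<open>The sign in \<open>dual_rep\<close> cancels against the outer signs, leaving the plain
  transpose of \<open>K x\<close>. Later computations with the right action go through this
  form.\<close>

lemma coadjoint_right_apply: "(- L_dual br x u - R_dual br x u) z = u (K x z)"
  if "u \<in> dual_space s"
  using that by (simp add: fun_op_apply L_dual_def R_dual_def dual_rep_def K_def dualD)

lemma L_dual_closed: "u \<in> dual_space s \<Longrightarrow> L_dual br x u \<in> dual_space s"
  by (intro dualI) (simp_all add: L_dual_apply br_simps dualD)

lemma L_dual_simps:
  "L_dual br x (u + v) = L_dual br x u + L_dual br x v"
  "L_dual br x (dual_scale c u) = dual_scale c (L_dual br x u)"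
  "u \<in> dual_space s \<Longrightarrow> L_dual br (x + y) u = L_dual br x u + L_dual br y u"
  "u \<in> dual_space s \<Longrightarrow> L_dual br (s c x) u = dual_scale c (L_dual br x u)"
  by (rule ext, simp add: L_dual_apply dual_scale_def br_simps dualD)+

lemma coadjoint_right_closed:
  "u \<in> dual_space s \<Longrightarrow> - L_dual br x u - R_dual br x u \<in> dual_space s"
  by (intro dualI) (simp_all only: coadjoint_right_apply K_simps dualD)

text \<open>The three axioms are the transposes of the Leibniz identity, of
  \<open>K_derivation\<close>, and of a consequence of \<open>left_center\<close>.\<close>

lemma coadjoint_representation:
  "leibniz_representation s br (L_dual br) (\<lambda>x v. - L_dual br x v - R_dual br x v)
    dual_scale (dual_space s)"
  (is "leibniz_representation s br ?l ?\<rho> _ _")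
proof -
  have \<rho>: "?\<rho> x (u + v) = ?\<rho> x u + ?\<rho> x v" "?\<rho> x (dual_scale c u) = dual_scale c (?\<rho> x u)" for x u v c
    by (rule ext, simp add: fun_op_apply L_dual_def R_dual_def dual_rep_def dual_scale_def algebra_simps)+
  have \<rho>': "?\<rho> (x + y) v = ?\<rho> x v + ?\<rho> y v" "?\<rho> (s c x) v = dual_scale c (?\<rho> x v)"
    if "v \<in> dual_space s" for x y v c
    by (rule ext, simp only: coadjoint_right_apply[OF that] dual_scale_def K_simps dualD[OF that]
        plus_fun_apply)+
  have bl: "bilinear_map_on s UNIV dual_scale (dual_space s) dual_scale (dual_space s) ?l"
    unfolding bilinear_map_on_def linear_map_on_def
    using L_dual_simps L_dual_closed by blast
  have b\<rho>: "bilinear_map_on s UNIV dual_scale (dual_space s) dual_scale (dual_space s) ?\<rho>"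
    unfolding bilinear_map_on_def linear_map_on_def
    using \<rho> \<rho>' coadjoint_right_closed by blast
  have r1: "?l (br x y) v = ?l x (?l y v) - ?l y (?l x v)" if v: "v \<in> dual_space s" for x y v
    by (rule ext) (simp add: fun_op_apply L_dual_apply leibniz_identity[of x y] dualD[OF v])
  have r2: "?\<rho> (br x y) v = ?l x (?\<rho> y v) - ?\<rho> y (?l x v)" if v: "v \<in> dual_space s" for x y v
  proof (rule ext)
    fix z
    show "?\<rho> (br x y) v z = (?l x (?\<rho> y v) - ?\<rho> y (?l x v)) z"
      unfolding diff_fun_apply[of "?l x _"] coadjoint_right_apply[OF v]
        coadjoint_right_apply[OF L_dual_closed[OF v]] L_dual_apply
      by (simp add: K_derivation dualD[OF v])
  qed
  have r3: "?\<rho> y (?l x v) = - ?\<rho> y (?\<rho> x v)" if v: "v \<in> dual_space s" for x y v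
  proof (rule ext)
    fix z
    \<comment> \<open>The other summand, \<open>br (K y z) x\<close>, is 0 because symmetrised
      brackets act trivially from the left.\<close>
    have "K x (K y z) = br x (K y z)"
      by (simp add: K_def[of x] left_center)
    then show "?\<rho> y (?l x v) z = (- ?\<rho> y (?\<rho> x v)) z"
      unfolding uminus_fun_apply[of "?\<rho> y _"] coadjoint_right_apply[OF v] L_dual_apply
        coadjoint_right_apply[OF L_dual_closed[OF v]] coadjoint_right_apply[OF coadjoint_right_closed[OF v]]
      by simp
  qed
  show ?thesis
    unfolding leibniz_representation_def
    using fin_dim_space_dual[OF fin_dim] bl b\<rho> r1 r2 r3 by blast
qed

section \<open>Equivariance of the operator of an invariant tensor\<close>

lemma invariant_pairing:
  assumes "F_op s br x t = 0" "t \<in> tensor2_space s" and u: "u \<in> dual_space s" and v: "v \<in> dual_space s"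
  shows "v (T_op s t (- L_dual br x u - R_dual br x u)) = v (br (T_op s t u) x)"
proof -
  have R: "(\<lambda>q. v (br q x)) \<in> dual_space s"
    by (intro dualI) (simp_all add: br_simps dualD v)
  have "bilinear_form s (\<lambda>p q. u p * v q)"
    using u v by (rule bilinear_form_prod)
  \<comment> \<open>Evaluated at a product of functionals, the two terms of \<open>F_op\<close> move
    \<open>K x\<close> onto \<open>u\<close> and right multiplication by \<open>x\<close> onto
    \<open>v\<close>; invariance equates them.\<close>
  then have "F_op s br x t (\<lambda>p q. u p * v q) =
      t (\<lambda>p q. u (K x p) * v q) - t (\<lambda>p q. u p * v (br q x))"
    by (simp add: F_op_def tensor_map_def diff_fun_apply K_def)
  with assms(1) have "t (\<lambda>p q. u (K x p) * v q) = t (\<lambda>p q. u p * v (br q x))"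
    by simp
  then show ?thesis
    unfolding T_op_pairing[OF vs assms(2) coadjoint_right_closed[OF u] v]
      T_op_pairing[OF vs assms(2) u R]
    by (simp only: tensor_pairing_def coadjoint_right_apply[OF u])
qed

lemma T_op_equivariant_right:
  assumes "F_op s br x t = 0" "t \<in> tensor2_space s" "u \<in> dual_space s"
  shows "T_op s t (- L_dual br x u - R_dual br x u) = br (T_op s t u) x"
  using invariant_pairing[OF assms] by (rule dual_separates[OF vs])

lemma T_op_skew:
  assumes "t \<in> tensor2_space s" "tensor_swap t = - t" "u \<in> dual_space s" "v \<in> dual_space s"
  shows "v (T_op s t u) = - u (T_op s t v)"
proof -
  have "v (T_op s t u) = tensor_pairing (tensor_swap t) v u"
    using T_op_pairing[OF vs assms(1,3,4)]
    by (simp add: tensor_pairing_def tensor_swap_def mult.commute)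
  also have "\<dots> = - u (T_op s t v)"
    unfolding assms(2) T_op_pairing[OF vs assms(1,4,3)]
    by (simp add: tensor_pairing_def fun_op_apply)
  finally show ?thesis .
qed

text \<open>Invariance alone gives equivariance for the right action only. Skewness transposes that
  relation, and left multiplication is \<open>K x\<close> minus right multiplication.\<close>

lemma T_op_equivariant_left:
  assumes inv: "F_op s br x t = 0" and t: "t \<in> tensor2_space s" and skew: "tensor_swap t = - t"
    and u: "u \<in> dual_space s"
  shows "T_op s t (L_dual br x u) = br x (T_op s t u)"
proof (rule dual_separates[OF vs])
  fix w assume w: "w \<in> dual_space s"
  let ?T = "T_op s t"
  have right: "- p (K x (?T q)) = q (br (?T p) x)" if "p \<in> dual_space s" "q \<in> dual_space s" for p q
    using T_op_skew[OF t skew coadjoint_right_closed[OF that(1)] that(2), of x]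
      T_op_equivariant_right[OF inv t that(1)]
    by (simp only: coadjoint_right_apply[OF that(1)])
  have "w (?T (L_dual br x u)) = u (br x (?T w))"
    using T_op_skew[OF t skew L_dual_closed[OF u] w] by (simp add: L_dual_apply)
  \<comment> \<open>By \<open>right\<close>, both this expression and the next one equal
    \<open>u (K x (?T w)) + w (K x (?T u))\<close>, which is symmetric in \<open>u\<close> and
    \<open>w\<close>.\<close>
  also have "\<dots> = u (K x (?T w)) - u (br (?T w) x)"
    by (simp add: K_def dualD u)
  also have "\<dots> = w (K x (?T u)) - w (br (?T u) x)"
    by (simp only: right[OF u w, symmetric] right[OF w u, symmetric]) simp
  also have "\<dots> = w (br x (?T u))"
    by (simp add: K_def dualD w)
  finally show "w (?T (L_dual br x u)) = w (br x (?T u))" .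
qed

text \<open>As the product is \<open>L_dual br (?S u) v\<close>, equivariance of \<open>?S\<close>
  reduces the Leibniz identity and the first two compatibility axioms to the commutator rule
  \<open>l_br\<close>. The third axiom also needs skewness.\<close>

lemma A_leibniz_algebra_circ:
  assumes inv: "\<And>x. F_op s br x t = 0" and t: "t \<in> tensor2_space s" and skew: "tensor_swap t = - t"
  shows "A_leibniz_algebra s br (L_dual br) (\<lambda>x v. - L_dual br x v - R_dual br x v)
    dual_scale (dual_space s) (circ s br t)"
  (is "A_leibniz_algebra s br ?l ?\<rho> _ ?V _")
proof -
  let ?S = "T_op s t"
  note rep = coadjoint_representation
  have l_br: "?l (br x y) v = ?l x (?l y v) - ?l y (?l x v)"
    and \<rho>_br: "?\<rho> (br x y) v = ?l x (?\<rho> y v) - ?\<rho> y (?l x v)" if "v \<in> ?V" for x y v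
    using rep that unfolding leibniz_representation_def by blast+
  have S: "?S (u + v) = ?S u + ?S v" "?S (dual_scale c u) = s c (?S u)"
    if "u \<in> ?V" "v \<in> ?V" for u v c
    using T_op_linear[OF vs t] that unfolding linear_map_on_def by blast+
  note Sl = T_op_equivariant_left[OF inv t skew] and S\<rho> = T_op_equivariant_right[OF inv t]
  have circ_bilinear: "bilinear_map_on dual_scale ?V dual_scale ?V dual_scale ?V (circ s br t)"
    unfolding bilinear_map_on_def linear_map_on_def circ_def
    by (auto simp: L_dual_simps S L_dual_closed)
  have dual: "leibniz_algebra dual_scale ?V (circ s br t)"
    unfolding leibniz_algebra_def
    using fin_dim_space_dual[OF fin_dim] circ_bilinear
    by (auto simp: circ_def Sl l_br)
  have right: "?l (?S u) (?\<rho> x v) = ?\<rho> x (?l (?S u) v) + ?l (?S v) (?\<rho> x u)"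
    if u: "u \<in> ?V" and v: "v \<in> ?V" for x u v
  proof -
    \<comment> \<open>By \<open>\<rho>_br\<close> the left side is the commutator of
      \<open>?l (?S u)\<close> and \<open>?\<rho> x\<close> on \<open>v\<close>, so this equation is
      the third axiom.\<close>
    have "?\<rho> (br (?S u) x) v = ?l (?S v) (?\<rho> x u)"
    proof (rule ext)
      fix z
      \<comment> \<open>Skewness applied to \<open>?\<rho> x u\<close> and
        \<open>?\<rho> z v\<close>, where \<open>?S\<close> turns each right action into a right
        multiplication.\<close>
      have "v (K z (br (?S u) x)) = - u (K x (br (?S v) z))"
        using T_op_skew[OF t skew coadjoint_right_closed[OF u] coadjoint_right_closed[OF v], of z x]
        by (simp only: S\<rho> u v coadjoint_right_apply)
      then show "?\<rho> (br (?S u) x) v z = ?l (?S v) (?\<rho> x u) z"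
        unfolding L_dual_apply[of _ "- _ - _"] coadjoint_right_apply[OF u] coadjoint_right_apply[OF v]
        by (simp add: K_def add.commute)
    qed
    with \<rho>_br[OF v, of "?S u" x] show ?thesis
      by (simp add: algebra_simps)
  qed
  have left: "?l x (?l (?S u) v) = ?l (?S (?l x u)) v + ?l (?S u) (?l x v)"
    and mixed: "?l (?S u) (?l x v) = ?l (?S (?\<rho> x u)) v + ?l x (?l (?S u) v)"
    if "u \<in> ?V" "v \<in> ?V" for x u v
    by (simp_all only: Sl S\<rho> that l_br) simp_all
  show ?thesis
    unfolding A_leibniz_algebra_def
    by (intro conjI allI ballI rep dual; unfold circ_def; (rule left mixed right; assumption))
qed

section \<open>The Yang-Baxter equation and the Rota-Baxter identity\<close>

lemma yang_baxter_eq_0_iff: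
  assumes "r \<in> tensor2_space s"
  defines "T \<equiv> T_op s r" and "T' \<equiv> T_op s (tensor_swap r)"
  shows "yang_baxter s br r = 0 \<longleftrightarrow>
    (\<forall>u\<in>dual_space s. \<forall>v\<in>dual_space s. \<forall>w\<in>dual_space s.
      w (br (T u) (T v)) = u (K (T v) (T' w)) - v (br (T' u) (T' w)))"
proof -
  obtain n a b where r: "r = (\<Sum>i<(n::nat). tensor2 s (a i) (b i))"
    using assms(1) unfolding tensor2_space_def by blast
  have T: "T u = (\<Sum>i<n. s (u (a i)) (b i))" "T' u = (\<Sum>i<n. s (u (b i)) (a i))"
    if "u \<in> dual_space s" for u
    using that by (simp_all add: T_def T'_def r tensor_swap_sum T_op_sum vs)
  \<comment> \<open>The functional \<open>v\<close> is put before \<open>u\<close> because the last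
    term of the sum carries the reversed bracket \<open>br (b j) (b i)\<close>; it then becomes
    \<open>br (T u) (T v)\<close> in the right order.\<close>
  have eval: "yang_baxter_sum s br n a b (\<lambda>x y z. v x * u y * w z) =
      v (br (T' u) (T' w)) - u (K (T v) (T' w)) + w (br (T u) (T v))"
    if u: "u \<in> dual_space s" and v: "v \<in> dual_space s" and w: "w \<in> dual_space s" for u v w
  proof -
    have 1: "v (br (T' u) (T' w)) = (\<Sum>i<n. \<Sum>j<n. v (br (a i) (a j)) * u (b i) * w (b j))"
      by (subst sum.swap) (simp add: T u w br_simps dualD[OF v] sum_distrib_left scale_sum_right mult_ac)
    have 2: "u (K (T v) (T' w)) =
        (\<Sum>i<n. \<Sum>j<n. v (a i) * u (br (b i) (a j) + br (a j) (b i)) * w (b j))"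
      unfolding K_def[symmetric]
      by (subst sum.swap) (simp add: T v w K_simps dualD[OF u] sum_distrib_left scale_sum_right mult_ac)
    have 3: "w (br (T u) (T v)) = (\<Sum>i<n. \<Sum>j<n. v (a i) * u (a j) * w (br (b j) (b i)))"
      by (simp add: T u v br_simps dualD[OF w] sum_distrib_left scale_sum_right mult_ac)
    show ?thesis
      using trilinear_form_prod[OF v u w]
      by (simp only: 1 2 3 yang_baxter_sum_def fun_op_apply tensor3_def plus_fun_apply if_True
          sum.distrib sum_subtractf)
  qed
  have sum_zero: "p - q + c = 0 \<longleftrightarrow> c = q - p" for p q c :: 'k
    using eq_neg_iff_add_eq_0[of c "p - q"] by (simp add: add.commute)
  have "yang_baxter s br r = 0 \<longleftrightarrow>
    (\<forall>u\<in>dual_space s. \<forall>v\<in>dual_space s. \<forall>w\<in>dual_space s.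
      yang_baxter_sum s br n a b (\<lambda>x y z. v x * u y * w z) = 0)"
    unfolding r yang_baxter_unique[OF leib] yang_baxter_sum_eq_0_iff[OF fin_dim] by blast
  also have "\<dots> \<longleftrightarrow> (\<forall>u\<in>dual_space s. \<forall>v\<in>dual_space s. \<forall>w\<in>dual_space s.
      w (br (T u) (T v)) = u (K (T v) (T' w)) - v (br (T' u) (T' w)))"
    by (intro ball_cong refl) (simp only: eval sum_zero)
  finally show ?thesis .
qed

text \<open>The Yang-Baxter condition is paired with \<open>w\<close>, the Rota-Baxter one is not;
  for each fixed \<open>u\<close> and \<open>v\<close> they agree because the dual separates
  points.\<close>

lemma yang_baxter_iff_rota_baxter:
  assumes r: "r \<in> tensor2_space s"
  defines "T \<equiv> T_op s r"
  shows "yang_baxter s br r = 0 \<longleftrightarrow>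
    (\<forall>u\<in>dual_space s. \<forall>v\<in>dual_space s. br (T u) (T v) =
      T (L_dual br (T u) v - (L_dual br (T v) u + R_dual br (T v) u) - circ s br (r - tensor_swap r) u v))"
proof -
  let ?T' = "T_op s (tensor_swap r)"
  have "br (T u) (T v) =
        T (L_dual br (T u) v - (L_dual br (T v) u + R_dual br (T v) u) - circ s br (r - tensor_swap r) u v) \<longleftrightarrow>
      (\<forall>w\<in>dual_space s. w (br (T u) (T v)) = u (K (T v) (?T' w)) - v (br (?T' u) (?T' w)))"
    (is "_ = T ?m \<longleftrightarrow> _") if u: "u \<in> dual_space s" and v: "v \<in> dual_space s" for u v
  proof -
    \<comment> \<open>Subtracting the induced product replaces \<open>T u\<close> by
      \<open>?T' u\<close> in the left action on \<open>v\<close>, since that product comes from the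
      difference of \<open>T\<close> and \<open>?T'\<close>.\<close>
    have m: "?m z = u (K (T v) z) - v (br (?T' u) z)" for z
      by (simp add: fun_op_apply circ_def L_dual_def R_dual_def dual_rep_def T_op_diff vs r u
          tensor2_space_swap T_def[symmetric] br_simps K_def dualD[OF u] dualD[OF v])
    have mV: "?m \<in> dual_space s"
      by (intro dualI; unfold m) (simp_all add: br_simps K_simps dualD[OF u] dualD[OF v] algebra_simps)
    \<comment> \<open>The adjoint moves \<open>T\<close> to the other side: the pairing is
      \<open>?m\<close> evaluated at \<open>?T' w\<close>.\<close>
    have "w (T ?m) = u (K (T v) (?T' w)) - v (br (?T' u) (?T' w))" if "w \<in> dual_space s" for w
      using T_op_adjoint[OF vs r mV that] unfolding T_def[symmetric] m .
    then show ?thesis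
      using dual_separates[OF vs] by metis
  qed
  then show ?thesis
    unfolding yang_baxter_eq_0_iff[OF r] T_def[symmetric] by blast
qed

end

theorem theorem4p9:
  fixes s :: "'k::{alg_closed_field, field_char_0} \<Rightarrow> 'a::ab_group_add \<Rightarrow> 'a"
    and br :: "'a \<Rightarrow> 'a \<Rightarrow> 'a"
    and r :: "('a, 'k) tensor2"
  assumes "leibniz_algebra s UNIV br"
    and "r \<in> tensor2_space s"
    and "\<forall>x. F_op s br x (r - tensor_swap r) = 0"
  shows "(lybe_solution s br r \<and> quasi_triangular_leibniz_bialgebra s br (coboundary s br r) \<longleftrightarrow>
      relative_rota_baxter_operator (- 1) s br (L_dual br) (\<lambda>x v. - L_dual br x v - R_dual br x v)
        dual_scale (dual_space s) (circ s br (r - tensor_swap r)) (T_op s r)) \<and>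
    (relative_rota_baxter_operator (- 1) s br (L_dual br) (\<lambda>x v. - L_dual br x v - R_dual br x v)
        dual_scale (dual_space s) (circ s br (r - tensor_swap r)) (T_op s r) \<longleftrightarrow>
      (\<forall>u\<in>dual_space s. \<forall>v\<in>dual_space s.
        br (T_op s r u) (T_op s r v) =
        T_op s r (L_dual br (T_op s r u) v - (L_dual br (T_op s r v) u + R_dual br (T_op s r v) u)
          - circ s br (r - tensor_swap r) u v)))"
proof -
  interpret leibniz s br
    by unfold_locales (rule assms(1))
  let ?t = "r - tensor_swap r"
  have t: "?t \<in> tensor2_space s"
    by (intro tensor2_space_diff vs assms(2) tensor2_space_swap)
  have skew: "tensor_swap ?t = - ?t"
    by (rule ext) (simp add: tensor_swap_def fun_op_apply)
  have eq: "L_dual br x v + (- L_dual br y u - R_dual br y u) + dual_scale (- 1) w =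
      L_dual br x v - (L_dual br y u + R_dual br y u) - w" for x y and u v w :: "'a \<Rightarrow> 'k"
    by (rule ext) (simp add: fun_op_apply dual_scale_def)
  \<comment> \<open>Invariance and skewness of \<open>?t\<close> supply the algebra structure on the
    dual, so only the Rota-Baxter identity remains.\<close>
  have RB: "relative_rota_baxter_operator (- 1) s br (L_dual br) (\<lambda>x v. - L_dual br x v - R_dual br x v)
      dual_scale (dual_space s) (circ s br ?t) (T_op s r) \<longleftrightarrow> yang_baxter s br r = 0"
    using A_leibniz_algebra_circ[OF assms(3)[rule_format] t skew] T_op_linear[OF vs assms(2)] assms(1)
    by (simp only: relative_rota_baxter_operator_def eq yang_baxter_iff_rota_baxter[OF assms(2)] simp_thms)
  \<comment> \<open>Quasi-triangularity asks only for some tensor with this coboundary: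
    \<open>r\<close> is the witness in one direction, and in the other the equation for
    \<open>r\<close> itself is read off the first conjunct.\<close>
  have QT: "lybe_solution s br r \<and> quasi_triangular_leibniz_bialgebra s br (coboundary s br r) \<longleftrightarrow>
      yang_baxter s br r = 0"
    using assms unfolding lybe_solution_def quasi_triangular_leibniz_bialgebra_def by blast
  show ?thesis
    unfolding RB QT yang_baxter_iff_rota_baxter[OF assms(2), symmetric] by simp
qed

end
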